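(* For an $n$-vertex graph $G$, whether $G$ has a HIST can be decided in $4^n n^{O(1)}$ time.
   Context: All graphs are finite, simple and undirected. A HIST (homeomorphically irreducible spanning tree) of a connected graph $G$ is a spanning tree of $G$ with no vertex of degree exactly $2$ in the tree. *)

theory Defs
  imports
    "Graph_Theory.Digraph_Component"
    "HOL-Library.Landau_Symbols"
    "HOL-Library.Log_Nat"
begin

section \<open>Homeomorphically irreducible spanning trees\<close>

text \<open>
  Finite simple undirected graphs are loop-free symmetric digraphs (locale \<^locale>\<open>pair_graph\<close>):
  an undirected edge is a pair of opposite arcs, so the out-degree is the undirected degree.
  A pair of opposite arcs is a directed cycle of length 2; therefore the library predicates
  \<^const>\<open>forest\<close>, \<^const>\<open>tree\<close> and \<^const>\<open>spanning_tree\<close> are not the undirected notions, and only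
  cycles of length at least 3 count here.
\<close>

definition undirected_tree :: "'a pair_pre_digraph \<Rightarrow> bool" where
  "undirected_tree T \<longleftrightarrow>
     pair_graph T \<and> connected (with_proj T) \<and>
     \<not> (\<exists>p. pre_digraph.cycle (with_proj T) p \<and> 3 \<le> length p)"

definition is_HIST :: "'a pair_pre_digraph \<Rightarrow> 'a pair_pre_digraph \<Rightarrow> bool" where
  "is_HIST T G \<longleftrightarrow>
     undirected_tree T \<and> spanning (with_proj T) (with_proj G) \<and>
     (\<forall>v \<in> pverts T. out_degree (with_proj T) v \<noteq> 2)"

text \<open>A disconnected graph (and the null graph) has no spanning tree, hence no HIST.\<close>

definition has_HIST :: "'a pair_pre_digraph \<Rightarrow> bool" where
  "has_HIST G \<longleftrightarrow> (\<exists>T. is_HIST T G)"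


section \<open>Random access machines with logarithmic cost\<close>

text \<open>
  The machine model is the RAM of Cook and Reckhow over the natural numbers: registers
  \<open>X\<^sub>0, X\<^sub>1, \<dots>\<close> are initially 0, addition and truncated subtraction are the only
  arithmetic operations, and the input is a finite sequence of numbers that is read
  sequentially (0 is read when it is exhausted).
\<close>

datatype instr =
    Const nat nat     \<comment> \<open>\<open>Const i c\<close>: \<open>X\<^sub>i := c\<close>\<close>
  | Add nat nat nat   \<comment> \<open>\<open>Add i j k\<close>: \<open>X\<^sub>i := X\<^sub>j + X\<^sub>k\<close>\<close>
  | Sub nat nat nat   \<comment> \<open>\<open>Sub i j k\<close>: \<open>X\<^sub>i := X\<^sub>j - X\<^sub>k\<close>, or 0 if \<open>X\<^sub>j < X\<^sub>k\<close>\<close>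
  | Load nat nat      \<comment> \<open>\<open>Load i j\<close>: \<open>X\<^sub>i := X\<^sub>m\<close> where \<open>m = X\<^sub>j\<close>\<close>
  | Store nat nat     \<comment> \<open>\<open>Store i j\<close>: \<open>X\<^sub>m := X\<^sub>j\<close> where \<open>m = X\<^sub>i\<close>\<close>
  | JumpPos nat nat   \<comment> \<open>\<open>JumpPos i l\<close>: if \<open>X\<^sub>i > 0\<close> continue at instruction \<open>l\<close>\<close>
  | Read nat          \<comment> \<open>\<open>Read i\<close>: \<open>X\<^sub>i :=\<close> next input number\<close>

type_synonym ram = "instr list"

text \<open>Program counter, registers, and the part of the input that has not been read yet.\<close>

type_synonym config = "nat \<times> (nat \<Rightarrow> nat) \<times> nat list"

fun next_input :: "nat list \<Rightarrow> nat" where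
  "next_input [] = 0"
| "next_input (x # xs) = x"

fun exec_instr :: "instr \<Rightarrow> config \<Rightarrow> config" where
  "exec_instr (Const i c) (pc, X, inp) = (Suc pc, X(i := c), inp)"
| "exec_instr (Add i j k) (pc, X, inp) = (Suc pc, X(i := X j + X k), inp)"
| "exec_instr (Sub i j k) (pc, X, inp) = (Suc pc, X(i := X j - X k), inp)"
| "exec_instr (Load i j) (pc, X, inp) = (Suc pc, X(i := X (X j)), inp)"
| "exec_instr (Store i j) (pc, X, inp) = (Suc pc, X(X i := X j), inp)"
| "exec_instr (JumpPos i l) (pc, X, inp) = (if X i > 0 then l else Suc pc, X, inp)"
| "exec_instr (Read i) (pc, X, inp) = (Suc pc, X(i := next_input inp), tl inp)"

text \<open>The length of the binary representation, with 0 having length 1.\<close>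

definition bin_length :: "nat \<Rightarrow> nat" where
  "bin_length n = max 1 (floorlog 2 n)"

text \<open>
  Logarithmic cost: an instruction is charged the binary lengths of all register addresses and
  register contents that it uses, so that no work can be hidden in large numbers.
\<close>

fun instr_cost :: "instr \<Rightarrow> config \<Rightarrow> nat" where
  "instr_cost (Const i c) (pc, X, inp) = bin_length i + bin_length c"
| "instr_cost (Add i j k) (pc, X, inp) =
     bin_length i + bin_length j + bin_length (X j) + bin_length k + bin_length (X k)"
| "instr_cost (Sub i j k) (pc, X, inp) =
     bin_length i + bin_length j + bin_length (X j) + bin_length k + bin_length (X k)"
| "instr_cost (Load i j) (pc, X, inp) =
     bin_length i + bin_length j + bin_length (X j) + bin_length (X (X j))"
| "instr_cost (Store i j) (pc, X, inp) =
     bin_length i + bin_length (X i) + bin_length j + bin_length (X j)"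
| "instr_cost (JumpPos i l) (pc, X, inp) = bin_length i + bin_length (X i)"
| "instr_cost (Read i) (pc, X, inp) = bin_length i + bin_length (next_input inp)"

text \<open>
  \<open>ram_run P c t c'\<close>: program \<open>P\<close> leads from \<open>c\<close> to \<open>c'\<close> in finitely many steps of total cost
  \<open>t\<close>. No step is possible once the program counter has left the program; the machine has
  then halted.
\<close>

inductive ram_run :: "ram \<Rightarrow> config \<Rightarrow> nat \<Rightarrow> config \<Rightarrow> bool" for P where
  refl: "ram_run P c 0 c"
| step: "fst c < length P \<Longrightarrow> ram_run P (exec_instr (P ! fst c) c) t c' \<Longrightarrow>
         ram_run P c (instr_cost (P ! fst c) c + t) c'"

text \<open>The answer of a halting run is found in register 0: 1 for yes, 0 for no.\<close>

definition ram_answers_within :: "ram \<Rightarrow> nat list \<Rightarrow> bool \<Rightarrow> nat \<Rightarrow> bool" where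
  "ram_answers_within P inp b t \<longleftrightarrow>
     (\<exists>t' pc X rest. t' \<le> t \<and> ram_run P (0, (\<lambda>_. 0), inp) t' (pc, X, rest) \<and>
        length P \<le> pc \<and> X 0 = (if b then 1 else 0))"

text \<open>
  A graph whose vertices are listed by \<open>vs\<close> is presented as the number of its vertices,
  followed by the rows of its 0/1 adjacency matrix.
\<close>

definition graph_input :: "'a list \<Rightarrow> 'a pair_pre_digraph \<Rightarrow> nat list" where
  "graph_input vs G =
     length vs # [if (u, v) \<in> parcs G then 1 else 0. u \<leftarrow> vs, v \<leftarrow> vs]"

text \<open>
  \<open>T\<close> bounds the running time in terms of the number of vertices, for every order in which the
  vertices may be presented. Vertices are natural numbers so that one machine is claimed for all
  graphs; only the adjacency matrix is visible to it.
\<close>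

definition decides_HIST_in_time :: "ram \<Rightarrow> (nat \<Rightarrow> nat) \<Rightarrow> bool" where
  "decides_HIST_in_time P T \<longleftrightarrow>
     (\<forall>(G :: nat pair_pre_digraph) vs.
        pair_graph G \<and> distinct vs \<and> set vs = pverts G \<longrightarrow>
        ram_answers_within P (graph_input vs G) (has_HIST G) (T (card (pverts G))))"

end

(*
  A spanning tree can be grown from an edge by attaching one leaf at a time, and attaching leaves to
  a tree always gives a tree. Whether the result is a HIST, and which leaves can be attached next,
  depends only on the degree profile: for every vertex, whether it is missing (0) or has degree 1, 2
  or at least 3. There are 4^n profiles, each with at most n^2 successors, and attaching a leaf
  increases the profile read as a base-4 number. Hence a single pass through a table indexed by
  these numbers finds all profiles of subtrees, and G has a HIST iff a profile with all digits odd is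
  among them (for n >= 2).

  The program is written in a small structured language that compiles to the machine; since all
  numbers stay below 64 * 4^n, every instruction costs O(n), so counting steps suffices.
*)

theory Submission
  imports Defs "HOL-Real_Asymp.Real_Asymp"
begin

section \<open>Growing trees leaf by leaf\<close>

text \<open>A profile forgets which tree produced it. This is harmless: attaching \<open>y\<close>
  to \<open>v\<close> needs only that \<open>v\<close> is present and \<open>y\<close> absent, so
  every tree with that profile admits the leaf, and a pendant vertex closes no cycle. Degrees from 3
  on can be merged because degrees never decrease during growth and only the value 2 is forbidden at
  the end. Conversely, growth inside a given HIST ends with a subtree on the same vertices. To
  conclude that it also has the same degrees, it must be shown to be the whole tree. On the machine
  side there is neither multiplication nor division, so digits are found by subtracting tabulated
  powers of 4. The factor 64 leaves room for the largest array address, \<open>4 * j + 35\<close>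
  with \<open>j < 3 * 4 ^ n\<close>, and being a power of 2 it makes the binary length of the bound
  explicit. Two kinds of loops suffice for the time bound: the search with \<open>4 ^ n\<close>
  rounds, and all others with at most \<open>n * n\<close>.\<close>

definition attach :: "'a pair_pre_digraph \<Rightarrow> 'a \<Rightarrow> 'a \<Rightarrow> 'a pair_pre_digraph" where
  "attach T x y = \<lparr>pverts = insert y (pverts T), parcs = insert (x, y) (insert (y, x) (parcs T))\<rparr>"

lemma attach_sel [simp]:
  "pverts (attach T x y) = insert y (pverts T)"
  "parcs (attach T x y) = insert (x, y) (insert (y, x) (parcs T))"
  by (simp_all add: attach_def)

lemma pair_graph_iff:
  "pair_graph T \<longleftrightarrow> finite (pverts T) \<and> parcs T \<subseteq> pverts T \<times> pverts T \<and> sym (parcs T) \<and> irrefl (parcs T)"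
    (is "?L \<longleftrightarrow> ?R")
proof
  assume ?L
  then interpret pair_graph T .
  show ?R
    using pair_finite_verts arcs_symmetric
    by (auto simp: irrefl_def intro!: symI dest: in_arcsD1 in_arcsD2 no_loops')
next
  assume R: ?R
  then have "finite (parcs T)"
    by (meson finite_SigmaI finite_subset)
  with R show ?L
    by unfold_locales (auto simp: symmetric_def irrefl_def)
qed

text \<open>Library connectivity is strong connectivity of the symmetric closure. A symmetric arc
  set is its own closure, so connectivity becomes the existence of directed walks, as used in
  \<open>undirected_tree_iff\<close>.\<close>

lemma mk_symmetric_pair_graph:
  assumes "pair_graph T"
  shows "mk_symmetric (with_proj T) = T"
proof -
  interpret pair_graph T by fact
  have "(parcs T)\<inverse> = parcs T"
    using arcs_symmetric by auto
  moreover have "parcs (mk_symmetric (with_proj T)) = parcs T \<union> (parcs T)\<inverse>"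
    by (auto simp: mk_symmetric_def)
  ultimately show ?thesis
    by (intro pair_pre_digraph.equality) (simp_all add: mk_symmetric_def)
qed

lemma undirected_tree_iff:
  "undirected_tree T \<longleftrightarrow>
     pair_graph T \<and> pverts T \<noteq> {} \<and>
     (\<forall>u \<in> pverts T. \<forall>v \<in> pverts T. \<exists>p. pre_digraph.awalk (with_proj T) u p v) \<and>
     (\<forall>p. pre_digraph.cycle (with_proj T) p \<longrightarrow> length p < 3)"
proof (cases "pair_graph T")
  case True
  then interpret pair_graph T .
  show ?thesis
    using True
    by (auto simp: undirected_tree_def connected_def mk_symmetric_pair_graph strongly_connected_def
        reachable_awalk not_le)
qed (simp add: undirected_tree_def)

lemma pair_graph_attach:
  assumes "pair_graph T" "x \<in> pverts T" "y \<notin> pverts T"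
  shows "pair_graph (attach T x y)"
  using assms unfolding pair_graph_iff by (auto simp: sym_def irrefl_def)

lemma awalk_with_proj:
  "pre_digraph.awalk (with_proj T) u p v \<longleftrightarrow> u \<in> pverts T \<and> set p \<subseteq> parcs T \<and> pcas u p v"
  by (simp add: pre_digraph.awalk_def cas_with_proj_eq)

lemma pcas_append: "pcas u (p @ q) v \<longleftrightarrow> (\<exists>w. pcas u p w \<and> pcas w q v)"
  by (induct p arbitrary: u) auto

lemma pcas_last: "pcas u p v \<Longrightarrow> p \<noteq> [] \<Longrightarrow> snd (last p) = v"
  by (induct p arbitrary: u) auto

lemma pawalk_verts_pcas: "pcas u p v \<Longrightarrow> pawalk_verts u p = u # map snd p"
  by (induct p arbitrary: u) auto

text \<open>Behind its start, the vertex list of a walk is the list of arc heads. Cycles can thus be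
  treated as closed arc lists with distinct heads, and a repeated head refutes them.\<close>

lemma cycle_with_proj:
  "pre_digraph.cycle (with_proj T) p \<longleftrightarrow>
     (\<exists>u \<in> pverts T. set p \<subseteq> parcs T \<and> pcas u p u \<and> distinct (map snd p) \<and> p \<noteq> [])"
  by (auto simp: pre_digraph.cycle_def awalk_with_proj awalk_verts_with_proj_eq pawalk_verts_pcas)

text \<open>A cycle through a pendant vertex \<open>y\<close> enters \<open>y\<close> from \<open>x\<close> and leaves it to \<open>x\<close>.\<close>
lemma cycle_attach:
  assumes T: "parcs T \<subseteq> pverts T \<times> pverts T" and xy: "x \<in> pverts T" "y \<notin> pverts T"
    and c: "pre_digraph.cycle (with_proj (attach T x y)) p" and long: "3 \<le> length p"
  shows "pre_digraph.cycle (with_proj T) p"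
proof -
  let ?A = "insert (x, y) (insert (y, x) (parcs T))"
  obtain u where u: "u \<in> insert y (pverts T)" and p: "set p \<subseteq> ?A" "pcas u p u"
    and d: "distinct (map snd p)" "p \<noteq> []"
    using c by (auto simp: cycle_with_proj)
  have out: "e = (y, x)" if "e \<in> ?A" "fst e = y" for e
    using that T xy by (cases e) auto
  have "(x, y) \<notin> set p"
  proof
    assume "(x, y) \<in> set p"
    then obtain p1 p2 where s: "p = p1 @ (x, y) # p2"
      by (auto simp: in_set_conv_decomp)
    have p1: "pcas u p1 x" and p2: "pcas y p2 u"
      using p(2) by (auto simp: s pcas_append)
    show False
    \<comment> \<open>If \<open>(x, y)\<close> is the last arc, the closed walk starts at
      \<open>y\<close> and its first arc is \<open>(y, x)\<close>; otherwise \<open>(y, x)\<close>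
      comes next. With at least three arcs, the walk must come back to \<open>x\<close> by a further
      arc, which repeats the head \<open>x\<close>.\<close>
    proof (cases p2)
      case Nil
      then obtain e p3 where e: "p1 = e # p3"
        using long s by (cases p1) auto
      have "e = (y, x)"
        using out[of e] p p2 Nil by (auto simp: s e)
      moreover have "p3 \<noteq> []"
        using long Nil by (auto simp: s e)
      moreover have "snd (last p3) = x"
        using p1 \<open>p3 \<noteq> []\<close> pcas_last[OF p1] by (simp add: e)
      ultimately show False
        using d last_in_set[of p3] by (auto simp: s e image_iff)
    next
      case (Cons e p3)
      have e: "e = (y, x)"
        using out[of e] p p2 by (auto simp: s Cons)
      have "p1 = []"
      proof (rule ccontr)
        assume "p1 \<noteq> []"
        with pcas_last[OF p1] last_in_set[of p1] show False
          using d by (auto simp: s Cons e image_iff)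
      qed
      then have "u = x" "p3 \<noteq> []"
        using p1 long by (auto simp: s Cons)
      then have "snd (last p3) = x"
        using pcas_last[OF p2] by (simp add: Cons)
      then show False
        using d last_in_set[OF \<open>p3 \<noteq> []\<close>] by (auto simp: s Cons e image_iff)
    qed
  qed
  moreover have "(y, x) \<notin> set p"
  proof
    assume "(y, x) \<in> set p"
    then obtain p1 p2 where s: "p = p1 @ (y, x) # p2"
      by (auto simp: in_set_conv_decomp)
    have p1: "pcas u p1 y" and p2: "pcas x p2 u"
      using p(2) by (auto simp: s pcas_append)
    \<comment> \<open>The cyclic predecessor of \<open>(y, x)\<close> enters \<open>y\<close>; the
      only arc that can do so is \<open>(x, y)\<close>, just excluded.\<close>
    have "\<exists>e \<in> set p. snd e = y"
    proof (cases "p1 = []")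
      case False
      then show ?thesis
        using pcas_last[OF p1] last_in_set[of p1] by (auto simp: s)
    next
      case True
      then have "p2 \<noteq> []" "u = y"
        using long p1 by (auto simp: s)
      then show ?thesis
        using pcas_last[OF p2] last_in_set[of p2] by (auto simp: s)
    qed
    then obtain w where w: "(w, y) \<in> set p"
      by auto
    with p(1) have "(w, y) \<in> ?A"
      by blast
    with T xy have "w = x"
      by auto
    with w \<open>(x, y) \<notin> set p\<close> show False by simp
  qed
  ultimately have "set p \<subseteq> parcs T"
    using p(1) by auto
  moreover from this have "u \<in> pverts T"
    using d(2) p(2) T by (cases p) auto
  ultimately show ?thesis
    using p(2) d by (auto simp: cycle_with_proj)
qed

lemma undirected_tree_attach:
  assumes T: "undirected_tree T" and xy: "x \<in> pverts T" "y \<notin> pverts T"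
  shows "undirected_tree (attach T x y)"
proof -
  have g: "pair_graph T"
    using T by (simp add: undirected_tree_iff)
  have arcs: "parcs T \<subseteq> pverts T \<times> pverts T"
    using g by (simp add: pair_graph_iff)
  have conn: "\<exists>p. set p \<subseteq> parcs T \<and> pcas u p v" if "u \<in> pverts T" "v \<in> pverts T" for u v
    using T that by (auto simp: undirected_tree_iff awalk_with_proj)
  \<comment> \<open>Every pair is joined by a walk through \<open>x\<close>; the new vertex costs
    one extra arc at either end.\<close>
  have walk: "\<exists>p. set p \<subseteq> parcs (attach T x y) \<and> pcas u p v"
    if uv: "u \<in> insert y (pverts T)" "v \<in> insert y (pverts T)" for u v
  proof -
    have "\<exists>p. set p \<subseteq> parcs (attach T x y) \<and> pcas u p x"
    proof (cases "u = y")
      case True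
      then show ?thesis by (intro exI[of _ "[(y, x)]"]) auto
    next
      case False
      then show ?thesis using uv conn[of u x] xy by auto
    qed
    moreover have "\<exists>p. set p \<subseteq> parcs (attach T x y) \<and> pcas x p v"
    proof (cases "v = y")
      case True
      then show ?thesis by (intro exI[of _ "[(x, y)]"]) auto
    next
      case False
      then show ?thesis using uv conn[of x v] xy by auto
    qed
    ultimately obtain p q where "set p \<subseteq> parcs (attach T x y)" "pcas u p x"
      "set q \<subseteq> parcs (attach T x y)" "pcas x q v"
      by blast
    then show ?thesis
      by (intro exI[of _ "p @ q"]) (auto simp: pcas_append)
  qed
  have "length p < 3" if "pre_digraph.cycle (with_proj (attach T x y)) p" for p
    using cycle_attach[OF arcs xy that] T by (fastforce simp: undirected_tree_iff not_le[symmetric])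
  moreover have "pair_graph (attach T x y)"
    by (rule pair_graph_attach) (use g xy in auto)
  ultimately show ?thesis
    unfolding undirected_tree_iff awalk_with_proj using walk by auto
qed

lemma undirected_tree_singleton: "undirected_tree \<lparr>pverts = {r}, parcs = {}\<rparr>"
proof -
  have "pair_graph \<lparr>pverts = {r}, parcs = {}\<rparr>"
    by (simp add: pair_graph_iff sym_def irrefl_def)
  then show ?thesis
    by (auto simp: undirected_tree_iff awalk_with_proj cycle_with_proj intro!: exI[of _ "[]"])
qed

lemma out_degree_attach:
  assumes T: "pair_graph T" and xy: "x \<in> pverts T" "y \<notin> pverts T"
  shows "out_degree (with_proj (attach T x y)) u =
    (if u = x then Suc (out_degree (with_proj T) u)
     else if u = y then 1 else out_degree (with_proj T) u)"
proof -
  have arcs: "parcs T \<subseteq> pverts T \<times> pverts T" and "finite (pverts T)"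
    using T by (simp_all add: pair_graph_iff)
  then have fin: "finite (parcs T)"
    by (meson finite_SigmaI finite_subset)
  have "out_arcs (with_proj (attach T x y)) u =
    (if u = x then insert (x, y) (out_arcs (with_proj T) u)
     else if u = y then {(y, x)} else out_arcs (with_proj T) u)"
    using xy arcs by (auto simp: out_arcs_def)
  moreover have "(x, y) \<notin> out_arcs (with_proj T) u" "finite (out_arcs (with_proj T) u)"
    using xy arcs fin by (auto simp: out_arcs_def)
  ultimately show ?thesis
    using xy by (auto simp: out_degree_def card_insert_disjoint)
qed

text \<open>A walk from inside \<open>S\<close> to outside must cross over. With \<open>S\<close>
  the vertex set of a proper subtree, the crossing arc supplies the next leaf.\<close>

lemma boundary_arc:
  assumes T: "undirected_tree T" and S: "S \<subseteq> pverts T" "S \<noteq> {}" "S \<noteq> pverts T"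
  obtains x y where "(x, y) \<in> parcs T" "x \<in> S" "y \<notin> S"
proof -
  obtain u v where uv: "u \<in> S" "v \<in> pverts T" "v \<notin> S"
    using S by blast
  have "u \<in> pverts T"
    using uv S by blast
  then obtain p where "pre_digraph.awalk (with_proj T) u p v"
    using T uv unfolding undirected_tree_iff by metis
  then have p: "set p \<subseteq> parcs T" "pcas u p v"
    by (simp_all add: awalk_with_proj)
  have "\<exists>e \<in> set p. fst e \<in> S \<and> snd e \<notin> S"
    using p(2) \<open>u \<in> S\<close> \<open>v \<notin> S\<close>
  proof (induct p arbitrary: u)
    case (Cons e p)
    then show ?case by (cases "snd e \<in> S") auto
  qed simp
  then show ?thesis
    using p(1) that by fastforce
qed

text \<open>An arc missing from the smaller tree would close a long cycle with a path of that tree.\<close>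
lemma spanning_subtree_eq:
  assumes T: "undirected_tree T" and S: "undirected_tree S"
    and v: "pverts S = pverts T" and a: "parcs S \<subseteq> parcs T"
  shows "S = T"
proof -
  have gT: "pair_graph T" and gS: "pair_graph S"
    using T S by (simp_all add: undirected_tree_iff)
  interpret S: pair_graph S by fact
  interpret T: pair_graph T by fact
  have "parcs T \<subseteq> parcs S"
  proof (rule subrelI, rule ccontr)
    fix x y assume xy: "(x, y) \<in> parcs T" "(x, y) \<notin> parcs S"
    then have xyV: "x \<in> pverts T" "y \<in> pverts T" "x \<noteq> y"
      using T.in_arcsD1 T.in_arcsD2 T.no_loops' by blast+
    then obtain q where "S.awalk y q x"
      using S v unfolding undirected_tree_iff by metis
    then obtain p where p: "S.apath y p x"
      using S.apath_awalk_to_apath by blast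
    then have ap: "set p \<subseteq> parcs S" "pcas y p x" "distinct (pawalk_verts y p)"
      by (auto simp: S.apath_def awalk_with_proj)
    have "p \<noteq> []"
      using ap(2) xyV by auto
    \<comment> \<open>A one-arc path would be \<open>(y, x)\<close>, the reverse of the missing arc.
      Two arcs are what the closed walk needs to reach the forbidden length 3.\<close>
    have "2 \<le> length p"
    proof (rule ccontr)
      assume "\<not> 2 \<le> length p"
      then obtain e where "p = [e]"
        using \<open>p \<noteq> []\<close> by (cases p) (auto simp: Suc_le_eq)
      then have "(y, x) \<in> parcs S"
        using ap by (cases e) auto
      then show False
        using xy S.arcs_symmetric by blast
    qed
    moreover have "pawalk_verts y p = y # map snd p"
      using ap(2) by (rule pawalk_verts_pcas)
    then have "distinct (map snd ((x, y) # p))"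
      using ap(3) by simp
    then have "T.cycle ((x, y) # p)"
      unfolding cycle_with_proj using xy ap a xyV by (intro bexI[of _ x]) auto
    then have "length ((x, y) # p) < 3"
      using T by (simp only: undirected_tree_iff)
    ultimately show False
      by simp
  qed
  with v a show ?thesis
    by (intro pair_pre_digraph.equality) auto
qed

section \<open>Degree profiles as base-4 numbers\<close>

definition dig :: "nat \<Rightarrow> nat \<Rightarrow> nat" where
  "dig k i = k div 4 ^ i mod 4"

lemma dig_0 [simp]: "dig 0 i = 0"
  by (simp add: dig_def)

lemma dig_less: "dig k i < 4"
  by (simp add: dig_def)

text \<open>A digit below 3 absorbs the added unit, so nothing is carried past position
  \<open>i\<close>.\<close>

lemma add_power_div:
  fixes k :: nat
  assumes "dig k i < 3"
  shows "(k + 4 ^ i) div 4 ^ Suc i = k div 4 ^ Suc i"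
proof -
  let ?q = "k div 4 ^ i"
  have "(k + 4 ^ i) div 4 ^ i = Suc ?q"
    by simp
  moreover have "Suc ?q div 4 = ?q div 4"
    using assms unfolding dig_def by (simp add: div_Suc mod_Suc)
  ultimately show ?thesis
    by (simp add: div_mult2_eq mult.commute[of 4])
qed

lemma dig_add_power:
  assumes "dig k i < 3"
  shows "dig (k + 4 ^ i) j = (if j = i then Suc (dig k i) else dig k j)"
proof -
  consider "j < i" | "j = i" | "i < j" by linarith
  then show ?thesis
  proof cases
    case 1
    \<comment> \<open>The added power is a multiple of \<open>4 ^ Suc j\<close>, so the quotient at
      \<open>j\<close> changes by a multiple of 4.\<close>
    then have "(4::nat) ^ i = 4 ^ j * (4 * 4 ^ (i - Suc j))"
      by (metis Suc_diff_Suc power_Suc power_add le_add_diff_inverse less_imp_le_nat)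
    then have "(k + 4 ^ i) div 4 ^ j = k div 4 ^ j + 4 * 4 ^ (i - Suc j)"
      by simp
    then show ?thesis
      using 1 by (simp add: dig_def)
  next
    case 2
    then show ?thesis
      using assms by (simp add: dig_def mod_Suc)
  next
    case 3
    then have e: "(4::nat) ^ j = 4 ^ Suc i * 4 ^ (j - Suc i)"
      by (metis Suc_leI le_add_diff_inverse power_add)
    have "(k + 4 ^ i) div 4 ^ j = k div 4 ^ j"
      unfolding e by (simp only: div_mult2_eq add_power_div[OF assms])
    then show ?thesis
      using 3 by (simp add: dig_def)
  qed
qed

text \<open>Being below \<open>4 ^ n\<close> is a condition on the quotient by
  \<open>4 ^ Suc i\<close>, which a carry-free addition does not touch.\<close>

lemma add_power_less:
  fixes k :: nat
  assumes "dig k i < 3" "k < 4 ^ n" "i < n"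
  shows "k + 4 ^ i < 4 ^ n"
proof -
  have e: "(4::nat) ^ n = 4 ^ Suc i * 4 ^ (n - Suc i)"
    using assms(3) by (metis Suc_leI le_add_diff_inverse power_add)
  have "k div 4 ^ Suc i < 4 ^ (n - Suc i)"
    using assms(2) by (metis e less_mult_imp_div_less mult.commute)
  then have "(k + 4 ^ i) div 4 ^ Suc i < 4 ^ (n - Suc i)"
    by (simp only: add_power_div[OF assms(1)])
  then show ?thesis
    unfolding e by (subst (asm) div_less_iff_less_mult) (simp_all add: mult.commute)
qed

text \<open>
  A subtree is encoded by the number whose \<open>i\<close>-th base-4 digit is the degree of vertex \<open>i\<close>, cut
  off at 3. Digit 0 means that the vertex is not in the subtree, which excludes trees with a single
  vertex; the code 0 is the starting point from which all single edges are created.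
\<close>

definition grow :: "(nat \<Rightarrow> nat \<Rightarrow> bool) \<Rightarrow> nat \<Rightarrow> nat \<Rightarrow> nat \<Rightarrow> nat \<Rightarrow> bool" where
  "grow E k v y k' \<longleftrightarrow> E v y \<and> dig k y = 0 \<and> (1 \<le> dig k v \<or> k = 0) \<and>
     k' = k + 4 ^ y + (if dig k v \<le> 2 then 4 ^ v else 0)"

inductive profile :: "nat \<Rightarrow> (nat \<Rightarrow> nat \<Rightarrow> bool) \<Rightarrow> nat \<Rightarrow> bool" for n E where
  zero: "profile n E 0"
| grow: "profile n E k \<Longrightarrow> v < n \<Longrightarrow> y < n \<Longrightarrow> grow E k v y k' \<Longrightarrow> profile n E k'"

text \<open>Neither addition carries: digit \<open>y\<close> is 0, and digit \<open>v\<close> is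
  incremented only while at most 2. As \<open>v \<noteq> y\<close>, the first addition leaves digit
  \<open>v\<close> as the second one expects it.\<close>

lemma dig_grow:
  assumes "grow E k v y k'" "v \<noteq> y"
  shows "dig k' i = (if i = y then 1 else if i = v then min 3 (Suc (dig k v)) else dig k i)"
proof -
  have y: "dig k y = 0"
    using assms by (simp add: grow_def)
  have 1: "dig (k + 4 ^ y) i = (if i = y then 1 else dig k i)" for i
    using dig_add_power[of k y i] y by simp
  show ?thesis
  proof (cases "dig k v \<le> 2")
    case True
    then show ?thesis
      using assms dig_add_power[of "k + 4 ^ y" v i] by (auto simp: 1 grow_def)
  next
    case False
    then have "dig k v = 3"
      using dig_less[of k v] by linarith
    then show ?thesis
      using assms by (auto simp: 1 grow_def)
  qed
qed

lemma grow_less: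
  assumes "grow E k v y k'" "v \<noteq> y" "v < n" "y < n" "k < 4 ^ n"
  shows "k' < 4 ^ n"
proof -
  have "k + 4 ^ y < 4 ^ n"
    using assms by (intro add_power_less) (auto simp: grow_def)
  moreover have "dig (k + 4 ^ y) v = dig k v"
    using assms dig_add_power[of k y v] by (simp add: grow_def)
  ultimately show ?thesis
    using assms add_power_less[of "k + 4 ^ y" v n] by (auto simp: grow_def)
qed

lemma grow_increasing: "grow E k v y k' \<Longrightarrow> k < k'"
  by (simp add: grow_def)

text \<open>The last conjunct rules out vertices of degree 0, whose digit would coincide with that
  of a missing vertex.\<close>

definition has_profile :: "'a list \<Rightarrow> 'a pair_pre_digraph \<Rightarrow> nat \<Rightarrow> bool" where
  "has_profile vs T k \<longleftrightarrow>
     (\<forall>i < length vs. dig k i =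
        (if vs ! i \<in> pverts T then min 3 (out_degree (with_proj T) (vs ! i)) else 0)) \<and>
     (\<forall>u \<in> pverts T. 1 \<le> out_degree (with_proj T) u)"

lemma has_profile_attach:
  assumes T: "undirected_tree T" and vs: "distinct vs"
    and vy: "v < length vs" "y < length vs" "vs ! v \<in> pverts T" "vs ! y \<notin> pverts T"
    and E: "E v y" and k: "has_profile vs T k"
  obtains k' where "grow E k v y k'" "has_profile vs (attach T (vs ! v) (vs ! y)) k'"
proof -
  define k' where "k' = k + 4 ^ y + (if dig k v \<le> 2 then 4 ^ v else 0)"
  have g: "pair_graph T"
    using T by (simp add: undirected_tree_iff)
  have "v \<noteq> y"
    using vy by auto
  have dv: "dig k v = min 3 (out_degree (with_proj T) (vs ! v))" "1 \<le> dig k v"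
    using k vy by (auto simp: has_profile_def)
  have gr: "grow E k v y k'"
    using E k vy dv by (auto simp: grow_def k'_def has_profile_def)
  have "has_profile vs (attach T (vs ! v) (vs ! y)) k'"
    using k vy vs dv
    by (auto simp: has_profile_def dig_grow[OF gr \<open>v \<noteq> y\<close>] out_degree_attach[OF g vy(3,4)] nth_eq_iff_index_eq)
  with gr show thesis
    by (rule that)
qed

text \<open>The one-vertex tree has no profile, so the step out of code 0 is treated apart: it
  creates both ends of an edge at once.\<close>

lemma has_profile_edge:
  assumes vs: "distinct vs" and vy: "v < length vs" "y < length vs" "v \<noteq> y" and E: "E v y"
  obtains k' where "grow E 0 v y k'"
    "has_profile vs (attach \<lparr>pverts = {vs ! v}, parcs = {}\<rparr> (vs ! v) (vs ! y)) k'"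
proof -
  define k' where "k' = 0 + 4 ^ y + (if dig 0 v \<le> 2 then 4 ^ v else (0::nat))"
  let ?T = "\<lparr>pverts = {vs ! v}, parcs = {}\<rparr>"
  have g: "pair_graph ?T"
    by (simp add: pair_graph_iff sym_def irrefl_def)
  have gr: "grow E 0 v y k'"
    using E by (auto simp: grow_def k'_def)
  have ne: "vs ! v \<noteq> vs ! y"
    using vs vy by (simp add: nth_eq_iff_index_eq)
  have [simp]: "out_degree (with_proj ?T) u = 0" for u
    by (simp add: out_degree_def out_arcs_def)
  have "has_profile vs (attach ?T (vs ! v) (vs ! y)) k'"
    using vy vs ne
    by (auto simp: has_profile_def dig_grow[OF gr vy(3)] out_degree_attach[OF g] nth_eq_iff_index_eq)
  with gr show thesis
    by (rule that)
qed

section \<open>Reachable profiles and HISTs\<close>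

context
  fixes G :: "'a pair_pre_digraph" and vs :: "'a list" and n E
  assumes G: "pair_graph G" and vs: "distinct vs" "set vs = pverts G"
  defines "n \<equiv> length vs" and "E \<equiv> \<lambda>v y. (vs ! v, vs ! y) \<in> parcs G"
begin

text \<open>Whatever tree witnesses \<open>k\<close>, the digit tests of \<open>grow\<close> place
  \<open>v\<close> inside and \<open>y\<close> outside it, so the leaf can be attached. Code 0 is
  the one reachable code with no tree behind it.\<close>

lemma profile_sound:
  assumes "profile n E k"
  shows "k = 0 \<or> (\<exists>T. undirected_tree T \<and> pverts T \<subseteq> pverts G \<and> parcs T \<subseteq> parcs G \<and> has_profile vs T k)"
  using assms
proof induct
  case (grow k v y k')
  interpret G: pair_graph G by (rule G)
  have vy: "v < length vs" "y < length vs" "E v y" "E y v"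
    using grow by (auto simp: n_def grow_def E_def intro: G.arcs_symmetric)
  then have "v \<noteq> y"
    using G.no_loops' by (auto simp: E_def)
  have inG: "vs ! v \<in> pverts G" "vs ! y \<in> pverts G"
    using vy nth_mem unfolding vs(2)[symmetric] by blast+
  \<comment> \<open>The new code is determined by \<open>k\<close>, \<open>v\<close> and
    \<open>y\<close>, so the code supplied by the attachment lemmas is the given
    \<open>k'\<close>.\<close>
  have uniq: "k'' = k'" if "grow E k v y k''" for k''
    using that grow by (simp add: grow_def)
  show ?case
  proof (cases "k = 0")
    case True
    obtain k'' where k'': "grow E 0 v y k''"
      "has_profile vs (attach \<lparr>pverts = {vs ! v}, parcs = {}\<rparr> (vs ! v) (vs ! y)) k''"
      using has_profile_edge[where E = E, OF vs(1) vy(1,2) \<open>v \<noteq> y\<close> vy(3)] .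
    have "undirected_tree (attach \<lparr>pverts = {vs ! v}, parcs = {}\<rparr> (vs ! v) (vs ! y))"
      using vs vy \<open>v \<noteq> y\<close>
      by (intro undirected_tree_attach undirected_tree_singleton) (auto simp: nth_eq_iff_index_eq)
    then show ?thesis
      using k'' uniq True inG vy(3,4) by (intro disjI2 exI conjI) (auto simp: E_def)
  next
    case False
    then obtain T where T: "undirected_tree T" "pverts T \<subseteq> pverts G" "parcs T \<subseteq> parcs G" "has_profile vs T k"
      using grow by blast
    have "vs ! v \<in> pverts T" "vs ! y \<notin> pverts T"
      using T(4) vy grow(5) False by (fastforce simp: has_profile_def grow_def split: if_splits)+
    then obtain k'' where k'': "grow E k v y k''" "has_profile vs (attach T (vs ! v) (vs ! y)) k''"
      using has_profile_attach[where E = E, OF T(1) vs(1) vy(1,2) _ _ vy(3) T(4)] by blast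
    have "undirected_tree (attach T (vs ! v) (vs ! y))"
      using T(1) \<open>vs ! v \<in> pverts T\<close> \<open>vs ! y \<notin> pverts T\<close> by (rule undirected_tree_attach)
    then show ?thesis
      using k'' uniq T inG vy(3,4) by (intro disjI2 exI conjI) (auto simp: E_def)
  qed
qed simp

text \<open>Inside \<open>T\<close>, a subtree with \<open>m\<close> vertices is grown for each
  \<open>m\<close> from 2 to \<open>n\<close>. At \<open>m = n\<close> it spans \<open>T\<close> and
  hence equals \<open>T\<close>, so the profile reached is that of \<open>T\<close> itself.\<close>

lemma profile_complete:
  assumes T: "undirected_tree T" "pverts T = pverts G" "parcs T \<subseteq> parcs G" and n: "2 \<le> n"
  shows "\<exists>k < 4 ^ n. profile n E k \<and> has_profile vs T k"
proof -
  interpret T: pair_graph T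
    using T(1) by (simp add: undirected_tree_iff)
  have card: "card (pverts T) = n"
    using vs T(2) distinct_card n_def by metis
  have idx: "\<exists>v y. v < length vs \<and> y < length vs \<and> a = vs ! v \<and> b = vs ! y \<and> E v y \<and> v \<noteq> y"
    if "(a, b) \<in> parcs T" for a b
  proof -
    have "a \<in> set vs" "b \<in> set vs" "a \<noteq> b"
      using that T.in_arcsD1 T.in_arcsD2 T(2) vs T.no_loops' by blast+
    then show ?thesis
      using that T(3) unfolding in_set_conv_nth E_def by blast
  qed
  have "m \<le> n \<Longrightarrow> \<exists>S k. undirected_tree S \<and> pverts S \<subseteq> pverts T \<and> parcs S \<subseteq> parcs T \<and>
      card (pverts S) = m \<and> k < 4 ^ n \<and> profile n E k \<and> has_profile vs S k" if "2 \<le> m" for m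
    using that
  proof (induct m rule: nat_induct_at_least)
    case base
    obtain r where r: "r \<in> pverts T"
      using T(1) by (auto simp: undirected_tree_iff)
    have "{r} \<noteq> pverts T"
      using card n by (metis card_1_singleton_iff One_nat_def Suc_1 Suc_n_not_le_n)
    then obtain x y where xy: "(x, y) \<in> parcs T" "x = r" "y \<noteq> r"
      using boundary_arc[OF T(1), of "{r}"] r by auto
    obtain v w where vw: "v < length vs" "w < length vs" "x = vs ! v" "y = vs ! w" "E v w" "v \<noteq> w"
      using idx[OF xy(1)] by blast
    let ?S = "attach \<lparr>pverts = {vs ! v}, parcs = {}\<rparr> (vs ! v) (vs ! w)"
    obtain k' where k': "grow E 0 v w k'" "has_profile vs ?S k'"
      using has_profile_edge[where E = E, OF vs(1) vw(1,2,6,5)] .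
    have ne: "vs ! v \<noteq> vs ! w"
      using vs vw by (simp add: nth_eq_iff_index_eq)
    have "undirected_tree ?S"
      using ne by (intro undirected_tree_attach undirected_tree_singleton) auto
    moreover have "profile n E k'"
      using k'(1) vw by (intro profile.grow[OF profile.zero]) (auto simp: n_def)
    moreover have "k' < 4 ^ n"
      using vw by (intro grow_less[OF k'(1)]) (auto simp: n_def)
    moreover have "pverts ?S \<subseteq> pverts T" "parcs ?S \<subseteq> parcs T" "card (pverts ?S) = 2"
      using xy vw ne T.in_arcsD1 T.in_arcsD2 T.arcs_symmetric by auto
    ultimately show ?case
      using k'(2) by blast
  next
    case (Suc m)
    then obtain S k where S: "undirected_tree S" "pverts S \<subseteq> pverts T" "parcs S \<subseteq> parcs T"
      "card (pverts S) = m" and k: "k < 4 ^ n" "profile n E k" "has_profile vs S k"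
      by auto
    have "pverts S \<noteq> pverts T" "pverts S \<noteq> {}"
      using Suc S card by auto
    then obtain x y where xy: "(x, y) \<in> parcs T" "x \<in> pverts S" "y \<notin> pverts S"
      using boundary_arc[OF T(1) S(2)] by metis
    obtain v w where vw: "v < length vs" "w < length vs" "x = vs ! v" "y = vs ! w" "E v w" "v \<noteq> w"
      using idx[OF xy(1)] by blast
    let ?S = "attach S (vs ! v) (vs ! w)"
    obtain k' where k': "grow E k v w k'" "has_profile vs ?S k'"
      using has_profile_attach[where E = E, OF S(1) vs(1) vw(1,2) _ _ vw(5) k(3)] xy vw by blast
    have "undirected_tree ?S"
      using xy vw by (intro undirected_tree_attach S) auto
    moreover have "profile n E k'"
      using k'(1) k vw by (intro profile.grow[OF k(2)]) (auto simp: n_def)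
    moreover have "k' < 4 ^ n"
      using vw k by (intro grow_less[OF k'(1)]) (auto simp: n_def)
    moreover have "pverts ?S \<subseteq> pverts T" "parcs ?S \<subseteq> parcs T"
      using xy vw S T.in_arcsD1 T.in_arcsD2 T.arcs_symmetric by auto
    moreover have "finite (pverts S)"
      using S(2) T.pair_finite_verts by (rule finite_subset)
    then have "card (pverts ?S) = Suc m"
      using S(4) xy vw by simp
    ultimately show ?case
      using k'(2) by blast
  qed
  from this[OF n] obtain S k where S: "undirected_tree S" "pverts S \<subseteq> pverts T" "parcs S \<subseteq> parcs T"
      "card (pverts S) = n" and k: "k < 4 ^ n" "profile n E k" "has_profile vs S k"
    by blast
  have "pverts S = pverts T"
    using S card by (intro card_subset_eq) (auto simp: T.pair_finite_verts)
  then have "S = T"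
    by (rule spanning_subtree_eq[OF T(1) S(1) _ S(3)])
  with k show ?thesis
    by blast
qed

text \<open>The odd digits are 1 and 3: vertex present, degree different from 2. Odd digits
  everywhere also force all vertices of \<open>G\<close> into the tree, so spanning needs no
  separate test.\<close>

theorem has_HIST_iff_profile:
  assumes n: "2 \<le> n"
  shows "has_HIST G \<longleftrightarrow> (\<exists>k < 4 ^ n. profile n E k \<and> (\<forall>i < n. odd (dig k i)))"
proof
  assume "has_HIST G"
  then obtain T where "is_HIST T G"
    unfolding has_HIST_def by metis
  then have T: "undirected_tree T" "spanning (with_proj T) (with_proj G)"
    and deg: "\<And>v. v \<in> pverts T \<Longrightarrow> out_degree (with_proj T) v \<noteq> 2"
    by (simp_all add: is_HIST_def)
  have V: "pverts T = pverts G" "parcs T \<subseteq> parcs G"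
    using T(2) by (simp_all add: spanning_def subgraph_def)
  obtain k where k: "k < 4 ^ n" "profile n E k" "has_profile vs T k"
    using profile_complete[OF T(1) V n] by blast
  have "odd (dig k i)" if "i < n" for i
  proof -
    have v: "vs ! i \<in> pverts T"
      using that vs V by (auto simp: n_def)
    let ?d = "out_degree (with_proj T) (vs ! i)"
    have "dig k i = min 3 ?d" "1 \<le> ?d" "?d \<noteq> 2"
      using k(3) that v deg by (auto simp: has_profile_def n_def)
    then have "dig k i = 1 \<or> dig k i = 3"
      by linarith
    then show ?thesis
      by auto
  qed
  with k show "\<exists>k < 4 ^ n. profile n E k \<and> (\<forall>i < n. odd (dig k i))"
    by blast
next
  assume "\<exists>k < 4 ^ n. profile n E k \<and> (\<forall>i < n. odd (dig k i))"
  then obtain k where k: "profile n E k" and o: "\<And>i. i < n \<Longrightarrow> odd (dig k i)"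
    by blast
  \<comment> \<open>The digits of code 0 are all even, and \<open>n \<ge> 2\<close> guarantees a
    digit to inspect.\<close>
  have "k \<noteq> 0"
    using o[of 0] n by (metis dig_0 even_zero gr0I not_numeral_le_zero)
  then obtain T where T: "undirected_tree T" "pverts T \<subseteq> pverts G" "parcs T \<subseteq> parcs G" "has_profile vs T k"
    using profile_sound[OF k] by blast
  have "v \<in> pverts T \<and> out_degree (with_proj T) v \<noteq> 2" if v: "v \<in> pverts G" for v
  proof -
    obtain i where i: "i < n" "v = vs ! i"
      using v vs by (metis in_set_conv_nth n_def)
    show ?thesis
      using o[OF i(1)] T(4) i by (auto simp: has_profile_def n_def split: if_splits)
  qed
  then have "spanning (with_proj T) (with_proj G)" "\<forall>v \<in> pverts T. out_degree (with_proj T) v \<noteq> 2"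
    using T G by (auto simp: spanning_def subgraph_def compatible_def wf_digraph_wp_iff undirected_tree_iff
        pair_graph_iff pair_wf_digraph_def)
  then show "has_HIST G"
    using T(1) by (auto simp: has_HIST_def is_HIST_def)
qed

end

text \<open>Trees without an edge have no profile, so these sizes are settled apart: a single vertex
  has degree 0 and is its own HIST, the null graph has none. The answer is the number of vertices
  itself.\<close>

lemma has_HIST_small:
  assumes "pair_graph G" "card (pverts G) \<le> 1"
  shows "has_HIST G \<longleftrightarrow> card (pverts G) = 1"
proof -
  interpret pair_graph G by fact
  show ?thesis
  proof (cases "pverts G = {}")
    case True
    then show ?thesis
      by (auto simp: has_HIST_def is_HIST_def undirected_tree_iff spanning_def)
  next
    case False
    then have c: "card (pverts G) = 1"
      using assms(2) pair_finite_verts by (metis One_nat_def card_gt_0_iff le_antisym Suc_leI)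
    then obtain r where r: "pverts G = {r}"
      by (auto simp: card_1_singleton_iff)
    then have "parcs G = {}"
      using in_arcsD1 in_arcsD2 no_loops' by fastforce
    with r have "G = \<lparr>pverts = {r}, parcs = {}\<rparr>"
      by (intro pair_pre_digraph.equality) auto
    then have "is_HIST G G"
      using undirected_tree_singleton[of r] subgraph_refl
      by (auto simp: is_HIST_def spanning_def out_degree_def out_arcs_def)
    with c show ?thesis
      by (auto simp: has_HIST_def)
  qed
qed

section \<open>A structured language for the machine\<close>

text \<open>
  \<open>Unless i c\<close> skips \<open>c\<close> if \<open>X\<^sub>i > 0\<close>, and \<open>Repeat f i c\<close> executes \<open>c\<close> at least once and as long
  as \<open>X\<^sub>i > 0\<close> afterwards; both need only the conditional jump. The flag \<open>f\<close> tells which of two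
  bounds on the number of iterations enters the time bound.
\<close>

datatype com =
    Instr instr
  | Seq com com (infixr \<open>;;\<close> 60)
  | Unless nat com
  | Repeat bool nat com

fun code_length :: "com \<Rightarrow> nat" where
  "code_length (Instr i) = 1"
| "code_length (a ;; b) = code_length a + code_length b"
| "code_length (Unless i c) = Suc (code_length c)"
| "code_length (Repeat f i c) = Suc (code_length c)"

text \<open>\<open>l\<close> is the address at which the block will stand; jump targets are
  absolute.\<close>

fun code :: "nat \<Rightarrow> com \<Rightarrow> ram" where
  "code l (Instr i) = [i]"
| "code l (a ;; b) = code l a @ code (l + code_length a) b"
| "code l (Unless i c) = JumpPos i (Suc (l + code_length c)) # code (Suc l) c"
| "code l (Repeat f i c) = code l c @ [JumpPos i l]"

lemma length_code [simp]: "length (code l c) = code_length c"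
  by (induct c arbitrary: l) auto

text \<open>
  In the following, \<open>M\<close> bounds all register addresses and contents, and \<open>b\<close> bounds the number of
  iterations of a loop in terms of its flag.
\<close>

definition step_bound :: "nat \<Rightarrow> nat" where
  "step_bound M = 5 * bin_length M"

text \<open>Purely syntactic: a skipped body is still charged, and every loop is charged
  \<open>b f\<close> rounds. The bound for the whole program then follows by unfolding
  alone.\<close>

fun time_bound :: "nat \<Rightarrow> (bool \<Rightarrow> nat) \<Rightarrow> com \<Rightarrow> nat" where
  "time_bound M b (Instr i) = step_bound M"
| "time_bound M b (c ;; d) = time_bound M b c + time_bound M b d"
| "time_bound M b (Unless i c) = step_bound M + time_bound M b c"
| "time_bound M b (Repeat f i c) = b f * (time_bound M b c + step_bound M)"

fun small_instr :: "nat \<Rightarrow> instr \<Rightarrow> bool" where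
  "small_instr M (Const i c) \<longleftrightarrow> i \<le> M \<and> c \<le> M"
| "small_instr M (Add i j k) \<longleftrightarrow> i \<le> M \<and> j \<le> M \<and> k \<le> M"
| "small_instr M (Sub i j k) \<longleftrightarrow> i \<le> M \<and> j \<le> M \<and> k \<le> M"
| "small_instr M (Load i j) \<longleftrightarrow> i \<le> M \<and> j \<le> M"
| "small_instr M (Store i j) \<longleftrightarrow> i \<le> M \<and> j \<le> M"
| "small_instr M (JumpPos i l) \<longleftrightarrow> i \<le> M"
| "small_instr M (Read i) \<longleftrightarrow> i \<le> M"

fun small :: "nat \<Rightarrow> com \<Rightarrow> bool" where
  "small M (Instr i) \<longleftrightarrow> small_instr M i"
| "small M (c ;; d) \<longleftrightarrow> small M c \<and> small M d"
| "small M (Unless i c) \<longleftrightarrow> i \<le> M \<and> small M c"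
| "small M (Repeat f i c) \<longleftrightarrow> i \<le> M \<and> small M c"

text \<open>
  The precondition of a loop asserts a number \<open>K\<close> of iterations and
  an invariant indexed by the number of completed iterations.
\<close>

type_synonym assertion = "(nat \<Rightarrow> nat) \<Rightarrow> nat list \<Rightarrow> bool"

text \<open>Only addition and reading can exceed \<open>M\<close>, so only they carry a size check;
  other results are bounded by old contents or by \<open>small\<close>. Bare jumps are rejected
  because they arise only from compiling \<open>Unless\<close> and \<open>Repeat\<close>.\<close>

fun wp_instr :: "nat \<Rightarrow> instr \<Rightarrow> assertion \<Rightarrow> assertion" where
  "wp_instr M (Const i c) Q X inp \<longleftrightarrow> Q (X(i := c)) inp"
| "wp_instr M (Add i j k) Q X inp \<longleftrightarrow> X j + X k \<le> M \<and> Q (X(i := X j + X k)) inp"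
| "wp_instr M (Sub i j k) Q X inp \<longleftrightarrow> Q (X(i := X j - X k)) inp"
| "wp_instr M (Load i j) Q X inp \<longleftrightarrow> Q (X(i := X (X j))) inp"
| "wp_instr M (Store i j) Q X inp \<longleftrightarrow> Q (X(X i := X j)) inp"
| "wp_instr M (JumpPos i l) Q X inp \<longleftrightarrow> False"
| "wp_instr M (Read i) Q X inp \<longleftrightarrow> next_input inp \<le> M \<and> Q (X(i := next_input inp)) (tl inp)"

fun wp :: "nat \<Rightarrow> (bool \<Rightarrow> nat) \<Rightarrow> com \<Rightarrow> assertion \<Rightarrow> assertion" where
  "wp M b (Instr i) Q X inp \<longleftrightarrow> wp_instr M i Q X inp"
| "wp M b (c ;; d) Q X inp \<longleftrightarrow> wp M b c (wp M b d Q) X inp"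
| "wp M b (Unless i c) Q X inp \<longleftrightarrow> (if X i = 0 then wp M b c Q X inp else Q X inp)"
| "wp M b (Repeat f i c) Q X inp \<longleftrightarrow>
    (\<exists>K R. 0 < K \<and> K \<le> b f \<and> R (0::nat) X inp \<and>
      (\<forall>k < K. \<forall>X inp. R k X inp \<longrightarrow>
         wp M b c (\<lambda>X inp. R (Suc k) X inp \<and> (0 < X i \<longleftrightarrow> Suc k < K)) X inp) \<and>
      (\<forall>X inp. R K X inp \<longrightarrow> Q X inp))"

declare wp.simps(4) [simp del]

lemma wp_Seq: "wp M b (c ;; d) Q = wp M b c (wp M b d Q)"
  by (intro ext) simp

lemma wp_mono:
  "wp M b c Q X inp \<Longrightarrow> (\<And>X inp. Q X inp \<Longrightarrow> Q' X inp) \<Longrightarrow> wp M b c Q' X inp"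
proof (induct c arbitrary: Q Q' X inp)
  case (Instr i)
  from Instr(1) show ?case by (cases i) (simp_all, ((erule conjE)?, erule Instr(2))+)
next
  case (Seq c d)
  then have "wp M b c (wp M b d Q) X inp" by simp
  then have "wp M b c (wp M b d Q') X inp"
    by (rule Seq(1)) (rule Seq(2)[OF _ Seq(4)])
  then show ?case by simp
next
  case (Unless i c)
  show ?case
  proof (cases "X i = 0")
    case True
    with Unless(2) have "wp M b c Q X inp" by simp
    then have "wp M b c Q' X inp"
      by (rule Unless(1)) (rule Unless(3))
    with True show ?thesis by simp
  next
    case False
    with Unless(2) have "Q X inp" by simp
    then have "Q' X inp" by (rule Unless(3))
    with False show ?thesis by simp
  qed
next
  case (Repeat f i c)
  from Repeat(2)[unfolded wp.simps] obtain K R where KR: "0 < K \<and> K \<le> b f \<and> R 0 X inp \<and>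
      (\<forall>k < K. \<forall>X inp. R k X inp \<longrightarrow>
         wp M b c (\<lambda>X inp. R (Suc k) X inp \<and> (0 < X i \<longleftrightarrow> Suc k < K)) X inp) \<and>
      (\<forall>X inp. R K X inp \<longrightarrow> Q X inp)"
    by (elim exE)
  have "\<forall>X inp. R K X inp \<longrightarrow> Q' X inp"
    using KR Repeat(3) by simp
  with KR show ?case
    unfolding wp.simps by (intro exI[of _ K] exI[of _ R]) simp
qed

lemma wp_Repeat:
  assumes "0 < K" "K \<le> b f" "R 0 X inp"
    and "\<And>k X inp. k < K \<Longrightarrow> R k X inp \<Longrightarrow>
      wp M b c (\<lambda>X inp. R (Suc k) X inp \<and> (0 < X i \<longleftrightarrow> Suc k < K)) X inp"
    and "\<And>X inp. R K X inp \<Longrightarrow> Q X inp"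
  shows "wp M b (Repeat f i c) Q X inp"
  unfolding wp.simps using assms by (intro exI[of _ K] exI[of _ R]) simp

section \<open>Soundness of the preconditions for compiled code\<close>

lemma ram_run_trans:
  "ram_run P c t c' \<Longrightarrow> ram_run P c' t' c'' \<Longrightarrow> ram_run P c (t + t') c''"
proof (induct rule: ram_run.induct)
  case (step c t c')
  then show ?case
    using ram_run.step[OF step(1), of "t + t'"] by (simp add: add.assoc)
qed simp

lemma ram_run_one:
  assumes "l < length P" "exec_instr (P ! l) (l, s) = c" "instr_cost (P ! l) (l, s) = t"
  shows "ram_run P (l, s) t c"
proof -
  have "ram_run P (l, s) (instr_cost (P ! fst (l, s)) (l, s) + 0) (exec_instr (P ! fst (l, s)) (l, s))"
    by (rule ram_run.step[OF _ ram_run.refl]) (simp add: assms(1))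
  then show ?thesis
    by (simp only: fst_conv assms(2,3) add_0_right)
qed

lemma bin_length_mono: "m \<le> n \<Longrightarrow> bin_length m \<le> bin_length n"
  unfolding bin_length_def by (intro max.mono floorlog_mono order_refl)

text \<open>The costliest instructions, \<open>Add\<close> and \<open>Sub\<close>, are charged for
  three addresses and two contents: hence the 5 in \<open>step_bound\<close>.\<close>

lemma instr_cost_le:
  assumes "small_instr M i" "\<forall>r. X r \<le> M" "wp_instr M i Q X inp"
  shows "instr_cost i (l, X, inp) \<le> step_bound M"
proof -
  have b: "bin_length r \<le> bin_length M" if "r \<le> M" for r
    using that by (rule bin_length_mono)
  have X: "bin_length (X r) \<le> bin_length M" for r
    using assms(2) b by simp
  show ?thesis
  proof (cases i)
    case (Const x y)
    then show ?thesis using assms b[of x] b[of y] by (simp add: step_bound_def)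
  next
    case (Add x y z)
    then show ?thesis using assms b[of x] b[of y] b[of z] X[of y] X[of z] by (simp add: step_bound_def)
  next
    case (Sub x y z)
    then show ?thesis using assms b[of x] b[of y] b[of z] X[of y] X[of z] by (simp add: step_bound_def)
  next
    case (Load x y)
    then show ?thesis using assms b[of x] b[of y] X[of y] X[of "X y"] by (simp add: step_bound_def)
  next
    case (Store x y)
    then show ?thesis using assms b[of x] b[of y] X[of x] X[of y] by (simp add: step_bound_def)
  next
    case (JumpPos x y)
    then show ?thesis using assms by simp
  next
    case (Read x)
    then show ?thesis using assms b[of x] b[of "next_input inp"] by (simp add: step_bound_def)
  qed
qed

lemma wp_instr_exec:
  assumes "wp_instr M i Q X inp" "small_instr M i" "\<forall>r. X r \<le> M"
  shows "\<exists>X' inp'. (\<forall>l. exec_instr i (l, X, inp) = (Suc l, X', inp')) \<and> (\<forall>r. X' r \<le> M) \<and> Q X' inp'"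
proof -
  have "X j - X k \<le> M" for j k
    using assms(3) le_trans[OF diff_le_self] by blast
  then show ?thesis
    using assms by (cases i) simp_all
qed

text \<open>Quantifying over the surrounding code makes the statement independent of position, so
  that runs of adjacent blocks compose.\<close>

definition runs :: "com \<Rightarrow> nat \<Rightarrow> (nat \<Rightarrow> nat) \<times> nat list \<Rightarrow> (nat \<Rightarrow> nat) \<times> nat list \<Rightarrow> bool" where
  "runs c t s s' \<longleftrightarrow> (\<forall>l pre post. length pre = l \<longrightarrow>
     (\<exists>t' \<le> t. ram_run (pre @ code l c @ post) (l, s) t' (l + code_length c, s')))"

lemma runsE:
  assumes "runs c t s s'" "length pre = l" "P = pre @ code l c @ post"
  obtains t' where "t' \<le> t" "ram_run P (l, s) t' (l + code_length c, s')"
  using assms(1)[unfolded runs_def, rule_format, OF assms(2), of post] that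
  unfolding assms(3) by (elim exE conjE)

lemma runs_mono:
  assumes "runs c t s s'" "t \<le> t'"
  shows "runs c t' s s'"
  unfolding runs_def
proof (intro allI impI)
  fix l and pre post :: ram
  assume "length pre = l"
  then obtain u where "u \<le> t" "ram_run (pre @ code l c @ post) (l, s) u (l + code_length c, s')"
    by (rule runsE[OF assms(1)]) simp
  with assms(2) show "\<exists>u \<le> t'. ram_run (pre @ code l c @ post) (l, s) u (l + code_length c, s')"
    by (auto intro: exI[of _ u])
qed

lemma runs_Seq:
  assumes "runs c t s s'" "runs d t' s' s''"
  shows "runs (c ;; d) (t + t') s s''"
  unfolding runs_def
proof (intro allI impI)
  fix l and pre post :: ram
  assume l: "length pre = l"
  let ?P = "pre @ code l (c ;; d) @ post"
  obtain u where u: "u \<le> t" "ram_run ?P (l, s) u (l + code_length c, s')"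
    by (rule runsE[OF assms(1) l, of ?P "code (l + code_length c) d @ post"]) simp
  obtain v where v: "v \<le> t'"
    "ram_run ?P (l + code_length c, s') v (l + code_length c + code_length d, s'')"
    by (rule runsE[OF assms(2), of "pre @ code l c" _ ?P post]) (use l in simp_all)
  show "\<exists>w \<le> t + t'. ram_run ?P (l, s) w (l + code_length (c ;; d), s'')"
    using ram_run_trans[OF u(2) v(2)] u(1) v(1) by (auto simp: add.assoc intro!: exI[of _ "u + v"])
qed

text \<open>One round is peeled off: the backward jump returns to the start of the same block, so
  the remaining rounds are again a run of the whole loop.\<close>

lemma runs_Repeat:
  assumes c: "runs c t s (X, inp)" and small: "i \<le> M" "X i \<le> M"
    and rest: "0 < X i \<Longrightarrow> runs (Repeat f i c) t' (X, inp) s'"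
    and stop: "X i = 0 \<Longrightarrow> s' = (X, inp)"
  shows "runs (Repeat f i c) (t + step_bound M + (if 0 < X i then t' else 0)) s s'"
  unfolding runs_def
proof (intro allI impI)
  fix l and pre post :: ram
  assume l: "length pre = l"
  let ?P = "pre @ code l (Repeat f i c) @ post"
  obtain u where u: "u \<le> t" "ram_run ?P (l, s) u (l + code_length c, X, inp)"
    by (rule runsE[OF c l, of ?P "JumpPos i l # post"]) simp
  let ?j = "instr_cost (JumpPos i l) (l + code_length c, X, inp)"
  have j: "?j \<le> step_bound M"
    using small[THEN bin_length_mono] by (simp add: step_bound_def)
  have nth: "?P ! (l + code_length c) = JumpPos i l"
    using l by (simp add: nth_append)
  have jump: "ram_run ?P (l + code_length c, X, inp) ?j
      (if 0 < X i then l else Suc (l + code_length c), X, inp)"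
    by (rule ram_run_one) (use nth l in auto)
  show "\<exists>w \<le> t + step_bound M + (if 0 < X i then t' else 0).
     ram_run ?P (l, s) w (l + code_length (Repeat f i c), s')"
  proof (cases "0 < X i")
    case True
    obtain v where "v \<le> t'" "ram_run ?P (l, X, inp) v (l + code_length (Repeat f i c), s')"
      by (rule runsE[OF rest[OF True] l, of ?P post]) simp
    then show ?thesis
      using ram_run_trans[OF ram_run_trans[OF u(2) jump], of v] u(1) j True
      by (intro exI[of _ "u + ?j + v"]) (simp del: code.simps instr_cost.simps)
  next
    case False
    then show ?thesis
      using ram_run_trans[OF u(2) jump] u(1) j stop
      by (intro exI[of _ "u + ?j"]) (simp del: code.simps instr_cost.simps)
  qed
qed

theorem wp_sound:
  assumes "wp M b c Q X inp" "small M c" "\<forall>r. X r \<le> M"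
  shows "\<exists>X' inp'. runs c (time_bound M b c) (X, inp) (X', inp') \<and> (\<forall>r. X' r \<le> M) \<and> Q X' inp'"
  using assms
proof (induct c arbitrary: Q X inp)
  case (Instr i)
  have cost: "instr_cost i (l, X, inp) \<le> step_bound M" for l
    using Instr by (intro instr_cost_le[where Q = Q]) auto
  obtain X' inp' where X': "\<And>l. exec_instr i (l, X, inp) = (Suc l, X', inp')" "Q X' inp'" "\<forall>r. X' r \<le> M"
    using wp_instr_exec[of M i Q X inp] Instr by auto
  have "runs (Instr i) (step_bound M) (X, inp) (X', inp')"
    unfolding runs_def using cost X'(1)
    by (auto intro!: exI[of _ "instr_cost i (_, X, inp)"] ram_run_one)
  with X' show ?case by auto
next
  case (Seq c d)
  then obtain X1 inp1 where 1: "runs c (time_bound M b c) (X, inp) (X1, inp1)" "\<forall>r. X1 r \<le> M" "wp M b d Q X1 inp1"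
    using Seq(1)[of "wp M b d Q" X inp] Seq(3-5) by (simp only: wp.simps small.simps) blast
  then obtain X2 inp2 where "runs d (time_bound M b d) (X1, inp1) (X2, inp2)" "\<forall>r. X2 r \<le> M" "Q X2 inp2"
    using Seq(2)[of Q X1 inp1] Seq(4) by (simp only: small.simps) blast
  with runs_Seq[OF 1(1) this(1)] show ?case
    by (simp only: time_bound.simps) blast
next
  case (Unless i c)
  \<comment> \<open>The cost of a jump depends neither on its target nor on the program counter, so
    0 can stand for both.\<close>
  let ?j = "instr_cost (JumpPos i 0) (0, X, inp)"
  have j: "?j \<le> step_bound M"
    using Unless(3,4) bin_length_mono[of i M] bin_length_mono[of "X i" M] by (simp add: step_bound_def)
  have jump: "ram_run (pre @ code l (Unless i c) @ post) (l, X, inp) ?j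
      (if 0 < X i then Suc (l + code_length c) else Suc l, X, inp)" if "length pre = l" for pre post l
    by (rule ram_run_one) (use that in \<open>auto simp: nth_append\<close>)
  show ?case
  proof (cases "X i = 0")
    case True
    then obtain X' inp' where X': "runs c (time_bound M b c) (X, inp) (X', inp')" "\<forall>r. X' r \<le> M" "Q X' inp'"
      using Unless(1)[of Q X inp] Unless(2-4) by (simp only: wp.simps small.simps if_True) blast
    have "runs (Unless i c) (step_bound M + time_bound M b c) (X, inp) (X', inp')"
      unfolding runs_def
    proof (intro allI impI)
      fix l and pre post :: ram
      assume l: "length pre = l"
      let ?P = "pre @ code l (Unless i c) @ post"
      obtain u where u: "u \<le> time_bound M b c" "ram_run ?P (Suc l, X, inp) u (Suc l + code_length c, X', inp')"
        by (rule runsE[OF X'(1), of "pre @ [JumpPos i (Suc (l + code_length c))]" "Suc l" ?P post]) (use l in simp_all)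
      then show "\<exists>t \<le> step_bound M + time_bound M b c. ram_run ?P (l, X, inp) t (l + code_length (Unless i c), X', inp')"
        using ram_run_trans[OF jump[OF l], of _ u] True j
        by (intro exI[of _ "?j + u"]) (simp del: code.simps instr_cost.simps)
    qed
    with X' show ?thesis
      by (simp only: time_bound.simps) blast
  next
    case False
    have "runs (Unless i c) (step_bound M + time_bound M b c) (X, inp) (X, inp)"
      unfolding runs_def
      using jump j False by (auto intro!: exI[of _ ?j] simp del: code.simps instr_cost.simps)
    with False Unless(2,4) show ?thesis
      by (simp only: time_bound.simps wp.simps if_False) blast
  qed
next
  case (Repeat f i c)
  obtain K R where K: "0 < K" "K \<le> b f" and R0: "R 0 X inp"
    and body: "\<And>k X inp. k < K \<Longrightarrow> R k X inp \<Longrightarrow>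
         wp M b c (\<lambda>X inp. R (Suc k) X inp \<and> (0 < X i \<longleftrightarrow> Suc k < K)) X inp"
    and Q: "\<And>X inp. R K X inp \<Longrightarrow> Q X inp"
    using Repeat(2) unfolding wp.simps by blast
  let ?t = "time_bound M b c + step_bound M"
  \<comment> \<open>\<open>m\<close> counts the rounds still to come, so the invariant is entered at
    index \<open>K - m\<close>.\<close>
  have "\<exists>X' inp'. runs (Repeat f i c) (m * ?t) (X, inp) (X', inp') \<and> (\<forall>r. X' r \<le> M) \<and> R K X' inp'"
    if "0 < m" "m \<le> K" "R (K - m) X inp" "\<forall>r. X r \<le> M" for m X inp
    using that
  proof (induct m arbitrary: X inp)
    case (Suc m)
    obtain X1 inp1 where 1: "runs c (time_bound M b c) (X, inp) (X1, inp1)" "\<forall>r. X1 r \<le> M"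
      "R (K - m) X1 inp1" "0 < X1 i \<longleftrightarrow> 0 < m"
    proof -
      have e: "Suc (K - Suc m) = K - m" "K - Suc m < K" "K - m < K \<longleftrightarrow> 0 < m"
        using Suc(3) by auto
      show thesis
        using Repeat(1)[OF body[OF e(2) Suc(4)] _ Suc(5)] Repeat(3) that
        unfolding e(1,3) small.simps by metis
    qed
    show ?case
    proof (cases "m = 0")
      case True
      then have "runs (Repeat f i c) (time_bound M b c + step_bound M + 0) (X, inp) (X1, inp1)"
        using runs_Repeat[OF 1(1), of i M f 0 "(X1, inp1)"] 1 Repeat(3) by simp
      then show ?thesis
        using 1(2,3) True by (intro exI[of _ X1] exI[of _ inp1]) simp
    next
      case False
      then obtain X2 inp2 where 2: "runs (Repeat f i c) (m * ?t) (X1, inp1) (X2, inp2)"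
        "\<forall>r. X2 r \<le> M" "R K X2 inp2"
        using Suc(1)[of X1 inp1] Suc(3) 1(2,3) by fastforce
      then have "runs (Repeat f i c) (time_bound M b c + step_bound M + m * ?t) (X, inp) (X2, inp2)"
        using runs_Repeat[OF 1(1), of i M f "m * ?t" "(X2, inp2)"] 1 False Repeat(3) by simp
      then show ?thesis
        using 2(2,3) by (intro exI[of _ X2] exI[of _ inp2]) simp
    qed
  qed simp
  from this[of K X inp] obtain X' inp' where X': "runs (Repeat f i c) (K * ?t) (X, inp) (X', inp')"
    "\<forall>r. X' r \<le> M" "R K X' inp'"
    using K R0 Repeat(4) by fastforce
  have "K * ?t \<le> b f * ?t"
    using K(2) by (rule mult_le_mono1)
  then have "runs (Repeat f i c) (b f * ?t) (X, inp) (X', inp')"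
    by (rule runs_mono[OF X'(1)])
  with X'(2,3) Q show ?case
    by (simp only: time_bound.simps) blast
qed

corollary wp_answers:
  assumes "wp M b c (\<lambda>X _. X 0 = (if a then 1 else 0)) (\<lambda>_. 0) inp" "small M c"
  shows "ram_answers_within (code 0 c) inp a (time_bound M b c)"
proof -
  obtain X inp' where X: "runs c (time_bound M b c) (\<lambda>_. 0, inp) (X, inp')" "X 0 = (if a then 1 else 0)"
    using wp_sound[OF assms] by auto
  obtain t where "t \<le> time_bound M b c" "ram_run (code 0 c) (0, \<lambda>_. 0, inp) t (code_length c, X, inp')"
    by (rule runsE[OF X(1), of "[]" 0 "code 0 c" "[]"]) simp_all
  with X(2) show ?thesis
    unfolding ram_answers_within_def by (intro exI[of _ t] exI[of _ "code_length c"] exI[of _ X] exI[of _ inp']) simp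
qed

section \<open>The program\<close>

text \<open>
  Four arrays are interleaved above the scalar registers: 0 is the adjacency matrix, 1 the powers
  of 4, 2 the digits of the current code, and 3 marks the codes found so far. The scalar registers
  hold: 0 the answer, 2 the number \<open>n\<close> of vertices, 3 \<open>4\<^sup>n\<close>, 4 \<open>n\<^sup>2\<close>, 5 and 7 loop counters,
  6 the current code, 8 an array index, 9 the number of even digits, 10 and 11 the current pair of
  vertices, 18 to 20 the remainder, the digit and its parity during decoding, 21 the constant 0 and
  22 the constant 1. Registers 14 and 15 serve the address computation; the others are scratch.
\<close>

declare One_nat_def [simp del]

text \<open>The array lengths depend on the input, so the arrays are kept apart by residues modulo 4
  rather than by intervals. The offset 32 clears the scalar registers.\<close>

definition cell :: "nat \<Rightarrow> nat \<Rightarrow> nat" where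
  "cell a j = 4 * j + (32 + a)"

lemma cell_eq_iff [simp]: "a < 4 \<Longrightarrow> a' < 4 \<Longrightarrow> cell a j = cell a' j' \<longleftrightarrow> a = a' \<and> j = j'"
  unfolding cell_def by presburger

lemma cell_neq [simp]:
  "r < 32 \<Longrightarrow> cell a j \<noteq> r" "r < 32 \<Longrightarrow> r \<noteq> cell a j"
  by (simp_all add: cell_def)

lemma not_in_range_cell [simp]:
  "r < 32 \<Longrightarrow> r \<notin> range (cell a)"
  "a < 4 \<Longrightarrow> a' < 4 \<Longrightarrow> a \<noteq> a' \<Longrightarrow> cell a j \<notin> range (cell a')"
  by (auto simp: image_iff)

text \<open>Two doublings replace the multiplication by 4.\<close>

definition addr :: "nat \<Rightarrow> nat \<Rightarrow> com" where
  "addr a j = Instr (Add 14 j j) ;; Instr (Add 14 14 14) ;; Instr (Const 15 (32 + a)) ;; Instr (Add 14 14 15)"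

definition load :: "nat \<Rightarrow> nat \<Rightarrow> nat \<Rightarrow> com" where
  "load a i j = addr a j ;; Instr (Load i 14)"

definition store :: "nat \<Rightarrow> nat \<Rightarrow> nat \<Rightarrow> com" where
  "store a j i = addr a j ;; Instr (Store 14 i)"

lemma wp_load [simp]:
  "cell a (X j) \<le> M \<Longrightarrow> j \<noteq> 14 \<Longrightarrow> j \<noteq> 15 \<Longrightarrow>
   wp M b (load a i j) Q X inp \<longleftrightarrow> Q (X(14 := cell a (X j), 15 := 32 + a, i := X (cell a (X j)))) inp"
  by (simp add: load_def addr_def cell_def add.assoc[symmetric] fun_upd_twist)

lemma wp_store [simp]:
  "cell a (X j) \<le> M \<Longrightarrow> j \<noteq> 14 \<Longrightarrow> j \<noteq> 15 \<Longrightarrow> i \<noteq> 14 \<Longrightarrow> i \<noteq> 15 \<Longrightarrow>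
   wp M b (store a j i) Q X inp \<longleftrightarrow>
     Q (X(14 := cell a (X j), 15 := 32 + a, cell a (X j) := X i)) inp"
  by (simp add: store_def addr_def cell_def add.assoc[symmetric] fun_upd_twist)

text \<open>Here and below, adding register 21, which is never written and stays 0, copies a
  register.\<close>

definition square_prog :: com where
  "square_prog = Instr (Add 7 2 21) ;; Repeat False 7 (Instr (Add 4 4 2) ;; Instr (Sub 7 7 22))"

definition read_prog :: com where
  "read_prog = Instr (Add 7 4 21) ;; Instr (Const 8 0) ;;
     Repeat False 7 (Instr (Read 12) ;; store 0 8 12 ;; Instr (Add 8 8 22) ;; Instr (Sub 7 7 22))"

definition powers_prog :: com where
  "powers_prog = Instr (Add 7 2 21) ;; Instr (Const 8 0) ;; Instr (Const 3 1) ;;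
     Repeat False 7 (store 1 8 3 ;; Instr (Add 3 3 3) ;; Instr (Add 3 3 3) ;;
       Instr (Add 8 8 22) ;; Instr (Sub 7 7 22))"

text \<open>Truncated subtraction serves as comparison: register 13 is 0 exactly if the power in
  register 12 still fits into the remainder. Three trials suffice for a base-4 digit, and each
  success flips the parity flag in register 20.\<close>

definition digit_step :: com where
  "digit_step = Instr (Sub 13 12 18) ;;
     Unless 13 (Instr (Sub 18 18 12) ;; Instr (Add 19 19 22) ;; Instr (Sub 20 22 20))"

definition digit_prog :: com where
  "digit_prog = digit_step ;; digit_step ;; digit_step"

definition decode_step :: com where
  "decode_step = Instr (Sub 8 8 22) ;; load 1 12 8 ;; Instr (Const 19 0) ;; Instr (Const 20 1) ;;
     digit_prog ;; store 2 8 19 ;; Instr (Add 9 9 20)"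

definition decode_prog :: com where
  "decode_prog = Instr (Add 18 6 21) ;; Instr (Const 9 0) ;; Instr (Add 8 2 21) ;;
     Repeat False 8 decode_step"

text \<open>Register 13 still holds the digit of \<open>v\<close> from \<open>pair_prog\<close>.
  Subtracting 2 gives 0 exactly if the digit may be incremented; a saturated digit 3 is left
  alone.\<close>

definition mark_prog :: com where
  "mark_prog = load 1 16 11 ;; Instr (Add 16 16 6) ;; Instr (Const 12 2) ;; Instr (Sub 12 13 12) ;;
     Unless 12 (load 1 12 10 ;; Instr (Add 16 16 12)) ;; store 3 16 22"

text \<open>Register 17 sums the obstructions to \<open>grow\<close>: the negated matrix entry, the
  digit of \<open>y\<close>, and \<open>1 - ((1 - k) + d)\<close> with \<open>d\<close> the digit of
  \<open>v\<close>, which is 0 exactly if \<open>k = 0\<close> or \<open>d \<ge> 1\<close>.\<close>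

definition pair_prog :: com where
  "pair_prog = load 0 12 8 ;; load 2 13 10 ;; load 2 16 11 ;;
     Instr (Sub 17 22 12) ;; Instr (Add 17 17 16) ;;
     Instr (Sub 12 22 6) ;; Instr (Add 12 12 13) ;; Instr (Sub 12 22 12) ;; Instr (Add 17 17 12) ;;
     Unless 17 mark_prog"

definition next_pair_prog :: com where
  "next_pair_prog = Instr (Add 8 8 22) ;; Instr (Add 11 11 22) ;; Instr (Sub 12 2 11) ;;
     Unless 12 (Instr (Const 11 0) ;; Instr (Add 10 10 22)) ;; Instr (Sub 7 7 22)"

definition expand_prog :: com where
  "expand_prog = Unless 9 (Instr (Const 0 1)) ;;
     Instr (Const 10 0) ;; Instr (Const 11 0) ;; Instr (Const 8 0) ;; Instr (Add 7 4 21) ;;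
     Repeat False 7 (pair_prog ;; next_pair_prog)"

definition count_prog :: com where
  "count_prog = Instr (Add 6 6 22) ;; Instr (Sub 5 5 22)"

text \<open>\<open>Unless\<close> acts on 0, so the loaded mark is complemented to expand exactly
  the marked codes.\<close>

definition search_step :: com where
  "search_step = decode_prog ;; load 3 12 6 ;; Instr (Sub 12 22 12) ;; Unless 12 expand_prog ;; count_prog"

definition search_prog :: com where
  "search_prog = Instr (Const 6 0) ;; store 3 6 22 ;; Instr (Add 5 3 21) ;; Repeat True 5 search_step"

text \<open>Register 0 first receives \<open>n\<close>, the right answer for
  \<open>n \<le> 1\<close>. Register 12 is the truncated \<open>2 - n\<close>, which opens the
  general branch exactly if \<open>n \<ge> 2\<close>.\<close>

definition hist_prog :: com where
  "hist_prog = Instr (Read 2) ;; Instr (Const 22 1) ;; Instr (Const 12 2) ;; Instr (Sub 12 12 2) ;;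
     Instr (Add 0 2 21) ;;
     Unless 12 (Instr (Const 0 0) ;; square_prog ;; read_prog ;; powers_prog ;; search_prog)"

lemma square_le_power4: "n * n \<le> 4 ^ n" for n :: nat
proof -
  have "n \<le> 2 ^ n"
    by (rule less_imp_le) (rule less_exp)
  then have "n * n \<le> 2 ^ n * 2 ^ n"
    by (rule mult_le_mono) fact
  also have "\<dots> = 4 ^ n"
    by (simp flip: power_mult_distrib)
  finally show ?thesis .
qed

definition unchanged :: "nat set \<Rightarrow> (nat \<Rightarrow> nat) \<Rightarrow> (nat \<Rightarrow> nat) \<Rightarrow> bool" where
  "unchanged S X X' \<longleftrightarrow> (\<forall>r. r \<notin> S \<longrightarrow> X' r = X r)"

lemma unchangedD: "unchanged S X X' \<Longrightarrow> r \<notin> S \<Longrightarrow> X' r = X r"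
  by (simp add: unchanged_def)

lemma unchanged_trans: "unchanged S X X' \<Longrightarrow> unchanged S' X' X'' \<Longrightarrow> S' \<subseteq> S \<Longrightarrow> unchanged S X X''"
  unfolding unchanged_def by (metis subsetD)

section \<open>Verification of the subprograms for at least two vertices\<close>

context
  fixes n :: nat and rows :: "nat list"
  assumes n: "2 \<le> n" and rows: "length rows = n * n" "\<And>p. p < n * n \<Longrightarrow> rows ! p \<le> 1"
begin

abbreviation max_num :: nat where
  "max_num \<equiv> 64 * 4 ^ n"

abbreviation iterations :: "bool \<Rightarrow> nat" where
  "iterations \<equiv> \<lambda>f. if f then 4 ^ n else n * n"

definition entry where
  "entry v y \<longleftrightarrow> rows ! (v * n + y) = 1"

text \<open>The part of the memory fixed by the initialization; the search writes only elsewhere, so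
  \<open>base_unchanged\<close> carries it along.\<close>

definition base :: "(nat \<Rightarrow> nat) \<Rightarrow> bool" where
  "base X \<longleftrightarrow> X 22 = 1 \<and> X 2 = n \<and> X 3 = 4 ^ n \<and> X 4 = n * n \<and> X 21 = 0 \<and>
     (\<forall>p < n * n. X (cell 0 p) = rows ! p) \<and> (\<forall>i < n. X (cell 1 i) = 4 ^ i)"

lemma base_unchanged:
  assumes "base X" "unchanged S X X'" "S \<inter> ({2, 3, 4, 21, 22} \<union> range (cell 0) \<union> range (cell 1)) = {}"
  shows "base X'"
proof -
  have "X' r = X r" if "r \<in> {2, 3, 4, 21, 22} \<union> range (cell 0) \<union> range (cell 1)" for r
    using assms(2,3) that by (auto simp: unchanged_def)
  then show ?thesis
    using assms(1) by (simp add: base_def)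
qed

lemma sizes: "n \<le> 4 ^ n" "n * n \<le> 4 ^ n" "16 \<le> (4 :: nat) ^ n"
proof -
  show "n * n \<le> 4 ^ n"
    by (rule square_le_power4)
  then show "n \<le> 4 ^ n"
    by (meson le_square le_trans)
  show "16 \<le> (4 :: nat) ^ n"
    using power_increasing[OF n, of "4 :: nat"] by simp
qed

text \<open>The factor 3 covers \<open>k + 4 ^ y + 4 ^ v\<close>, three terms of at most
  \<open>4 ^ n\<close> with \<open>k\<close> strictly below, so \<open>mark_prog\<close> needs no
  argument about carries.\<close>

lemma cell_le: "a < 4 \<Longrightarrow> j < 3 * 4 ^ n \<Longrightarrow> cell a j \<le> max_num"
  unfolding cell_def using sizes(3) by linarith

lemma wp_square:
  assumes "X 2 = n" "X 4 = 0" "X 22 = 1" "X 21 = 0"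
  shows "wp max_num iterations square_prog
    (\<lambda>X' inp'. inp' = inp \<and> X' 4 = n * n \<and> unchanged {4, 7} X X') X inp"
proof -
  have *: "k * n + n \<le> max_num" if "k < n" for k
  proof -
    have "Suc k * n \<le> n * n"
      using that by (intro mult_le_mono1) simp
    then show ?thesis
      using sizes(2) by simp
  qed
  have 0: "X 2 + X 21 \<le> max_num"
    unfolding assms using sizes(1,3) by linarith
  show ?thesis
    unfolding square_prog_def
    apply (simp only: wp.simps(1,2) wp_instr.simps)
    apply (rule conjI, rule 0)
    apply (rule wp_Repeat[where K = n and
          R = "\<lambda>k X' inp'. inp' = inp \<and> X' 7 = n - k \<and> X' 4 = k * n \<and> unchanged {4, 7} X X'"])
    using n by (simp_all add: assms * unchanged_def Suc_eq_plus1 add_mult_distrib)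
qed

lemma wp_read:
  assumes "X 2 = n" "X 4 = n * n" "X 22 = 1" "X 21 = 0"
  shows "wp max_num iterations read_prog
    (\<lambda>X' inp'. unchanged ({7, 8, 12, 14, 15} \<union> range (cell 0)) X X' \<and>
      (\<forall>p < n * n. X' (cell 0 p) = rows ! p)) X rows"
proof -
  have drop: "next_input (drop p rows) = rows ! p" "tl (drop p rows) = drop (Suc p) rows" if "p < n * n" for p
    using that rows by (simp_all add: Cons_nth_drop_Suc[symmetric] tl_drop drop_Suc)
  have cell: "cell 0 p \<le> max_num" if "p < n * n" for p
    using that sizes(2,3) by (simp add: cell_def)
  have nn: "n * n + 1 \<le> max_num"
    using sizes(2,3) by linarith
  have one: "rows ! p \<le> max_num" if "p < n * n" for p
    using rows(2)[OF that] sizes(3) by linarith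
  show ?thesis
    unfolding read_prog_def
    apply (simp only: wp.simps(1,2) wp_instr.simps)
    apply (rule conjI)
     apply (use nn in \<open>simp add: assms\<close>)
    apply (rule wp_Repeat[where K = "n * n" and
          R = "\<lambda>k X' inp'. inp' = drop k rows \<and> X' 7 = n * n - k \<and> X' 8 = k \<and>
            unchanged ({7, 8, 12, 14, 15} \<union> range (cell 0)) X X' \<and>
            (\<forall>p < k. X' (cell 0 p) = rows ! p)"])
    subgoal using n by simp
    subgoal by simp
    subgoal by (simp add: assms unchanged_def)
    subgoal using nn by (auto simp add: assms drop cell one image_iff less_Suc_eq unchanged_def)
    subgoal by simp
    done
qed

lemma wp_powers:
  assumes "X 2 = n" "X 22 = 1" "X 21 = 0"
  shows "wp max_num iterations powers_prog
    (\<lambda>X' inp'. inp' = inp \<and> X' 3 = 4 ^ n \<and> unchanged ({3, 7, 8, 14, 15} \<union> range (cell 1)) X X' \<and>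
      (\<forall>i < n. X' (cell 1 i) = 4 ^ i)) X inp"
proof -
  have cell: "cell 1 p \<le> max_num" if "p < n" for p
    unfolding cell_def using that sizes(1,3) by linarith
  have nn: "n + 1 \<le> max_num"
    using sizes(1,3) by linarith
  have pow: "4 ^ Suc i \<le> (4 :: nat) ^ n" if "i < n" for i
    using that by (intro power_increasing) simp_all
  show ?thesis
    unfolding powers_prog_def
    apply (simp only: wp.simps(1,2) wp_instr.simps)
    apply (rule conjI)
     apply (use nn in \<open>simp add: assms\<close>)
    apply (rule wp_Repeat[where K = n and
          R = "\<lambda>k X' inp'. inp' = inp \<and> X' 7 = n - k \<and> X' 8 = k \<and> X' 3 = 4 ^ k \<and>
            unchanged ({3, 7, 8, 14, 15} \<union> range (cell 1)) X X' \<and>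
            (\<forall>p < k. X' (cell 1 p) = 4 ^ p)"])
    subgoal using n by simp
    subgoal using sizes by simp
    subgoal by (simp add: assms unchanged_def)
    subgoal for k using nn pow[of k] by (auto simp add: assms cell image_iff less_Suc_eq unchanged_def)
    subgoal by simp
    done
qed

text \<open>Exactly \<open>d\<close> of the three trial subtractions succeed, and fixing
  \<open>d\<close> decides each of them. The flag starts at 1, so it ends at 1 for even
  \<open>d\<close>.\<close>

lemma wp_digit_prog:
  assumes "X 12 = w" "X 18 = d * w + r" "r < w" "d < 4" "X 19 = 0" "X 20 = 1" "X 22 = 1"
  shows "wp max_num b digit_prog
    (\<lambda>X' inp'. inp' = inp \<and> X' 18 = r \<and> X' 19 = d \<and> X' 20 = (if odd d then 0 else 1) \<and>
      unchanged {13, 18, 19, 20} X X') X inp"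
proof -
  have M: "3 \<le> max_num"
    using sizes(3) by linarith
  consider "d = 0" | "d = 1" | "d = 2" | "d = 3"
    using \<open>d < 4\<close> by linarith
  then show ?thesis
    by cases (use assms(1-3,5-) M in \<open>simp_all add: digit_prog_def digit_step_def unchanged_def\<close>)
qed

lemma wp_decode_step:
  assumes X: "base X" "X 8 = Suc i" "i < n" "X 18 = d * 4 ^ i + r" "r < 4 ^ i" "d < 4" "X 9 \<le> n"
  shows "wp max_num b decode_step
    (\<lambda>X' inp'. inp' = inp \<and> X' 8 = i \<and> X' 18 = r \<and> X' (cell 2 i) = d \<and>
      X' 9 = X 9 + (if odd d then 0 else 1) \<and>
      unchanged {8, 9, 12, 13, 14, 15, 18, 19, 20, cell 2 i} X X') X inp"
proof -
  have cell: "cell a i \<le> max_num" if "a < 4" for a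
    unfolding cell_def using that \<open>i < n\<close> sizes(1,3) by linarith
  have M: "X 9 + 1 \<le> max_num"
    using X(7) sizes(1,3) by linarith
  have B: "X 22 = 1" "X (cell 1 i) = 4 ^ i"
    using X by (simp_all add: base_def)
  let ?d = "store 2 8 19 ;; Instr (Add 9 9 20)"
  let ?X = "X(8 := i, 14 := cell 1 i, 15 := 33, 12 := 4 ^ i, 19 := 0, 20 := 1)"
  define Q where "Q = (\<lambda>X' inp'. inp' = inp \<and> X' 8 = i \<and> X' 18 = r \<and> X' (cell 2 i) = d \<and>
      X' 9 = X 9 + (if odd d then 0 else 1) \<and>
      unchanged {8, 9, 12, 13, 14, 15, 18, 19, 20, cell 2 i} X X')"
  have "wp max_num b digit_prog (\<lambda>X' inp'. inp' = inp \<and> X' 18 = r \<and> X' 19 = d \<and> X' 20 = (if odd d then 0 else 1) \<and>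
      unchanged {13, 18, 19, 20} ?X X') ?X inp"
    by (rule wp_digit_prog[where w = "4 ^ i"]) (use X B in simp_all)
  then have "wp max_num b digit_prog (wp max_num b ?d Q) ?X inp"
    by (rule wp_mono) (use M in \<open>auto simp: Q_def unchanged_def cell\<close>)
  then have "wp max_num b decode_step Q X inp"
    by (simp add: decode_step_def B X(2) cell)
  then show ?thesis
    unfolding Q_def .
qed

lemma wp_decode:
  assumes X: "base X" "X 6 = k" "k < 4 ^ n"
  shows "wp max_num iterations decode_prog
    (\<lambda>X' inp'. inp' = inp \<and> (\<forall>i < n. X' (cell 2 i) = dig k i) \<and>
      (X' 9 = 0 \<longleftrightarrow> (\<forall>i < n. odd (dig k i))) \<and>
      unchanged ({8, 9, 12, 13, 14, 15, 18, 19, 20} \<union> range (cell 2)) X X') X inp"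
proof -
  let ?S = "{8, 9, 12, 13, 14, 15, 18, 19, 20} \<union> range (cell 2)"
  have B: "X 2 = n" "X 21 = 0"
    using X by (simp_all add: base_def)
  \<comment> \<open>Digits are produced from the top: after \<open>j\<close> rounds those from
    \<open>n - j\<close> on are known and the rest of \<open>k\<close> is its residue. The bound
    \<open>X' 9 \<le> j\<close> keeps the counter of even digits small enough for the next
    addition.\<close>
  define R where "R = (\<lambda>j X' inp'. inp' = inp \<and> X' 8 = n - j \<and> X' 18 = k mod 4 ^ (n - j) \<and>
    (\<forall>i < n. n - j \<le> i \<longrightarrow> X' (cell 2 i) = dig k i) \<and>
    (X' 9 = 0 \<longleftrightarrow> (\<forall>i < n. n - j \<le> i \<longrightarrow> odd (dig k i))) \<and> X' 9 \<le> j \<and> unchanged ?S X X')"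
  have step: "wp max_num iterations decode_step (\<lambda>X inp. R (Suc j) X inp \<and> (0 < X 8 \<longleftrightarrow> Suc j < n)) Y inp'"
    if j: "j < n" and Y: "R j Y inp'" for j Y inp'
  proof -
    define i where "i = n - Suc j"
    have i: "n - j = Suc i" "n - Suc j = i" "i < n" "0 < i \<longleftrightarrow> Suc j < n"
      using j by (auto simp: i_def)
    have "base Y"
      by (rule base_unchanged[OF X(1), of ?S]) (use Y in \<open>auto simp: R_def\<close>)
    moreover have "k mod 4 ^ Suc i = dig k i * 4 ^ i + k mod 4 ^ i"
      unfolding dig_def by (metis mod_mult2_eq mult.commute power_Suc2)
    then have "Y 18 = dig k i * 4 ^ i + k mod 4 ^ i"
      using Y by (simp add: R_def i(1))
    ultimately have "wp max_num iterations decode_step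
      (\<lambda>X' inp''. inp'' = inp' \<and> X' 8 = i \<and> X' 18 = k mod 4 ^ i \<and> X' (cell 2 i) = dig k i \<and>
        X' 9 = Y 9 + (if odd (dig k i) then 0 else 1) \<and>
        unchanged {8, 9, 12, 13, 14, 15, 18, 19, 20, cell 2 i} Y X') Y inp'"
      by (intro wp_decode_step) (use Y i j dig_less in \<open>auto simp: R_def\<close>)
    then show ?thesis
    proof (rule wp_mono, elim conjE)
      fix X' inp''
      assume e: "inp'' = inp'" "X' 8 = i" "X' 18 = k mod 4 ^ i" "X' (cell 2 i) = dig k i"
        "X' 9 = Y 9 + (if odd (dig k i) then 0 else 1)"
        "unchanged {8, 9, 12, 13, 14, 15, 18, 19, 20, cell 2 i} Y X'"
      have split: "(\<forall>i' < n. i \<le> i' \<longrightarrow> P i') \<longleftrightarrow> P i \<and> (\<forall>i' < n. Suc i \<le> i' \<longrightarrow> P i')" for P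
        using i(3) by (metis Suc_leD Suc_leI le_eq_less_or_eq)
      have "unchanged ?S X X'"
        by (rule unchanged_trans[OF _ e(6)]) (use Y in \<open>auto simp: R_def\<close>)
      moreover have "X' (cell 2 i') = Y (cell 2 i')" if "Suc i \<le> i'" for i'
        using that by (intro unchangedD[OF e(6)]) auto
      ultimately show "R (Suc j) X' inp'' \<and> (0 < X' 8 \<longleftrightarrow> Suc j < n)"
        using Y e(1-5) i(3,4) unfolding R_def i(1,2) split by auto
    qed
  qed
  show ?thesis
    unfolding decode_prog_def
    apply (simp add: B X(2) del: One_nat_def)
    apply (intro conjI)
      apply (use X(3) in linarith)
     apply (use sizes in linarith)
    apply (rule wp_Repeat[where K = n and R = R])
    subgoal using n by simp
    subgoal by simp
    subgoal using X(3) by (auto simp: R_def unchanged_def)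
    subgoal by (rule step)
    subgoal by (auto simp: R_def)
    done
qed

lemma wp_mark:
  assumes X: "base X" "X 6 = k" "k < 4 ^ n" "X 13 = dig k v"
    and p: "X 10 = v" "X 11 = y" "v < n" "y < n"
    and t: "t = k + 4 ^ y + (if dig k v \<le> 2 then 4 ^ v else 0)"
  shows "wp max_num b mark_prog
    (\<lambda>X' inp'. inp' = inp \<and> X' (cell 3 t) = 1 \<and> unchanged {12, 14, 15, 16, cell 3 t} X X') X inp"
proof -
  have B: "X 22 = 1" "X (cell 1 v) = 4 ^ v" "X (cell 1 y) = 4 ^ y"
    using X p by (simp_all add: base_def)
  have pow: "4 ^ v \<le> (4 :: nat) ^ n" "4 ^ y \<le> (4 :: nat) ^ n"
    using p(3,4) by (simp_all add: power_increasing)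
  have cells: "cell a v \<le> max_num \<and> cell a y \<le> max_num \<and> cell a (4 ^ y + k) \<le> max_num \<and> cell a (4 ^ y + k + 4 ^ v) \<le> max_num"
    if "a < 4" for a
    by (intro conjI cell_le that; insert pow p(3,4) X(3) sizes(1); linarith)
  have sums: "4 ^ y + k \<le> max_num" "4 ^ y + k + 4 ^ v \<le> max_num"
    using pow X(3) sizes by linarith+
  show ?thesis
    using cells[of 1] cells[of 3] sums
    by (simp add: mark_prog_def B X(2,4) p(1,2) t unchanged_def add.commute[of _ k])
qed

lemma wp_pair:
  assumes X: "base X" "X 6 = k" "k < 4 ^ n" "\<forall>i < n. X (cell 2 i) = dig k i"
    and p: "X 8 = v * n + y" "X 10 = v" "X 11 = y" "v < n" "y < n"
  shows "wp max_num b pair_prog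
    (\<lambda>X' inp'. inp' = inp \<and> unchanged ({12, 13, 14, 15, 16, 17} \<union> range (cell 3)) X X' \<and>
      (\<forall>j. X' (cell 3 j) = (if grow entry k v y j then 1 else X (cell 3 j)))) X inp"
proof -
  have vy: "v * n + y < n * n"
  proof -
    have "Suc v * n \<le> n * n"
      using p(4) by (intro mult_le_mono1) simp
    then show ?thesis
      using p(5) by simp
  qed
  have B: "X 22 = 1" "X (cell 0 (v * n + y)) = rows ! (v * n + y)"
    using X vy by (simp_all add: base_def)
  have cells: "cell 0 (v * n + y) \<le> max_num \<and> cell 2 v \<le> max_num \<and> cell 2 y \<le> max_num"
    by (intro conjI cell_le; insert vy p(4,5) sizes(1,2); linarith)
  have sums: "1 + dig k y \<le> max_num" "1 + dig k v \<le> max_num" "1 + dig k y + 1 \<le> max_num"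
    using dig_less[of k y] dig_less[of k v] sizes by linarith+
  define t where "t = k + 4 ^ y + (if dig k v \<le> 2 then 4 ^ v else 0)"
  let ?g = "rows ! (v * n + y) = 1 \<and> dig k y = 0 \<and> (1 \<le> dig k v \<or> k = 0)"
  have g: "grow entry k v y j \<longleftrightarrow> ?g \<and> j = t" for j
    by (auto simp: grow_def entry_def t_def)
  define Q where "Q = (\<lambda>X' inp'. inp' = inp \<and> unchanged ({12, 13, 14, 15, 16, 17} \<union> range (cell 3)) X X' \<and>
      (\<forall>j. X' (cell 3 j) = (if ?g \<and> j = t then 1 else X (cell 3 j))))"
  define f where "f = (1 - rows ! (v * n + y)) + dig k y"
  define e where "e = 1 - ((1 - k) + dig k v)"
  have f: "f \<le> 1 + dig k y" "e \<le> 1" "f + e = 0 \<longleftrightarrow> ?g"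
    using rows(2)[OF vy] by (auto simp: f_def e_def)
  let ?X = "X(13 := dig k v, 14 := cell 2 y, 15 := 34, 16 := dig k y, 12 := e, 17 := f + e)"
  have "wp max_num b mark_prog Q ?X inp" if ?g
  proof -
    have "base ?X"
      by (rule base_unchanged[OF X(1), of "{12, 13, 14, 15, 16, 17}"]) (auto simp: unchanged_def)
    then have "wp max_num b mark_prog
      (\<lambda>X' inp'. inp' = inp \<and> X' (cell 3 t) = 1 \<and> unchanged {12, 14, 15, 16, cell 3 t} ?X X') ?X inp"
      by (rule wp_mark) (use X p in \<open>simp_all add: t_def\<close>)
    then show ?thesis
      by (rule wp_mono) (use that in \<open>auto simp: Q_def unchanged_def\<close>)
  qed
  moreover have "Q ?X inp" if "\<not> ?g"
    using that by (auto simp: Q_def unchanged_def)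
  ultimately have "if f + e = 0 then wp max_num b mark_prog Q ?X inp else Q ?X inp"
    using f(3) by simp
  moreover have "1 - k + dig k v \<le> max_num" "1 - rows ! (v * n + y) + dig k y \<le> max_num" "f + e \<le> max_num"
    using sums f(1,2) by linarith+
  ultimately have "wp max_num b pair_prog Q X inp"
    using cells X(4) p(4,5)
    by (cases "f + e = 0") (simp_all add: pair_prog_def B X(2) p(1-3) flip: f_def e_def)
  then show ?thesis
    unfolding g Q_def .
qed

lemma wp_next_pair:
  assumes X: "base X" and p: "p < n * n" "X 7 = n * n - p" "X 8 = p" "X 10 = p div n" "X 11 = p mod n"
  shows "wp max_num b next_pair_prog
    (\<lambda>X' inp'. inp' = inp \<and> unchanged {7, 8, 10, 11, 12} X X' \<and> X' 7 = n * n - Suc p \<and> X' 8 = Suc p \<and>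
      X' 10 = Suc p div n \<and> X' 11 = Suc p mod n) X inp"
proof -
  have B: "X 22 = 1" "X 2 = n"
    using X by (simp_all add: base_def)
  have "p div n \<le> p" "p mod n < n"
    using n by simp_all
  then have le: "Suc p \<le> max_num" "Suc (p mod n) \<le> max_num" "Suc (p div n) \<le> max_num"
    using p(1) sizes by linarith+
  have "Suc p div n = (if n \<le> p mod n + 1 then p div n + 1 else p div n)"
    "Suc p mod n = (if n \<le> p mod n + 1 then 0 else p mod n + 1)"
    using \<open>p mod n < n\<close> by (auto simp: div_Suc mod_Suc)
  then show ?thesis
    by (simp add: next_pair_prog_def B p(2-5) le unchanged_def Suc_eq_plus1[symmetric])
qed

lemma wp_expand:
  assumes X: "base X" "X 6 = k" "k < 4 ^ n" "\<forall>i < n. X (cell 2 i) = dig k i"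
  shows "wp max_num iterations expand_prog
    (\<lambda>X' inp'. inp' = inp \<and> X' 0 = (if X 9 = 0 then 1 else X 0) \<and>
      unchanged ({0, 7, 8, 10, 11, 12, 13, 14, 15, 16, 17} \<union> range (cell 3)) X X' \<and>
      (\<forall>j. X' (cell 3 j) = (if \<exists>v < n. \<exists>y < n. grow entry k v y j then 1 else X (cell 3 j)))) X inp"
proof -
  let ?S = "{0, 7, 8, 10, 11, 12, 13, 14, 15, 16, 17} \<union> range (cell 3)"
  have B: "X 4 = n * n" "X 21 = 0"
    using X by (simp_all add: base_def)
  \<comment> \<open>One counter \<open>p\<close> runs through all pairs as quotient and remainder by
    \<open>n\<close>; it is also the index of the matrix entry.\<close>
  have pairs: "(\<exists>p < n * n. grow entry k (p div n) (p mod n) j) \<longleftrightarrow> (\<exists>v < n. \<exists>y < n. grow entry k v y j)" for j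
  proof
    assume "\<exists>p < n * n. grow entry k (p div n) (p mod n) j"
    then show "\<exists>v < n. \<exists>y < n. grow entry k v y j"
      using n by (metis less_mult_imp_div_less mod_less_divisor less_le_trans pos2)
  next
    assume "\<exists>v < n. \<exists>y < n. grow entry k v y j"
    then obtain v y where vy: "v < n" "y < n" "grow entry k v y j"
      by blast
    have "Suc v * n \<le> n * n"
      using vy(1) by (intro mult_le_mono1) simp
    then show "\<exists>p < n * n. grow entry k (p div n) (p mod n) j"
      using vy by (intro exI[of _ "v * n + y"]) simp
  qed
  define R where "R = (\<lambda>p X' inp'. inp' = inp \<and> X' 7 = n * n - p \<and> X' 8 = p \<and>
    X' 10 = p div n \<and> X' 11 = p mod n \<and> X' 0 = (if X 9 = 0 then 1 else X 0) \<and> unchanged ?S X X' \<and>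
    (\<forall>j. X' (cell 3 j) = (if \<exists>p0 < p. grow entry k (p0 div n) (p0 mod n) j then 1 else X (cell 3 j))))"
  have step: "wp max_num iterations (pair_prog ;; next_pair_prog)
      (\<lambda>X inp. R (Suc p) X inp \<and> (0 < X 7 \<longleftrightarrow> Suc p < n * n)) Y inp'"
    if p: "p < n * n" and Y: "R p Y inp'" for p Y inp'
  proof -
    have baseY: "base Y"
      by (rule base_unchanged[OF X(1), of ?S]) (use Y in \<open>auto simp: R_def\<close>)
    have Y': "Y 6 = k" "\<forall>i < n. Y (cell 2 i) = dig k i"
      using Y X unchangedD[of ?S X Y 6] unchangedD[of ?S X Y "cell 2 _"] by (auto simp: R_def)
    have pn: "p div n < n" "p mod n < n" "p = p div n * n + p mod n"
      using p n by (simp_all add: less_mult_imp_div_less)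
    have "wp max_num iterations pair_prog
    (\<lambda>X' inp''. inp'' = inp' \<and> unchanged ({12, 13, 14, 15, 16, 17} \<union> range (cell 3)) Y X' \<and>
      (\<forall>j. X' (cell 3 j) = (if grow entry k (p div n) (p mod n) j then 1 else Y (cell 3 j)))) Y inp'"
      by (rule wp_pair[OF baseY Y'(1) X(3) Y'(2)]) (use Y pn in \<open>simp_all add: R_def\<close>)
    then have "wp max_num iterations pair_prog (wp max_num iterations next_pair_prog
      (\<lambda>X inp. R (Suc p) X inp \<and> (0 < X 7 \<longleftrightarrow> Suc p < n * n))) Y inp'"
    proof (rule wp_mono, elim conjE)
      fix Z inp''
      assume Z: "inp'' = inp'" "unchanged ({12, 13, 14, 15, 16, 17} \<union> range (cell 3)) Y Z"
        "\<forall>j. Z (cell 3 j) = (if grow entry k (p div n) (p mod n) j then 1 else Y (cell 3 j))"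
      have "base Z"
        by (rule base_unchanged[OF baseY Z(2)]) auto
      then have "wp max_num iterations next_pair_prog
        (\<lambda>X' inp'. inp' = inp'' \<and> unchanged {7, 8, 10, 11, 12} Z X' \<and> X' 7 = n * n - Suc p \<and> X' 8 = Suc p \<and>
          X' 10 = Suc p div n \<and> X' 11 = Suc p mod n) Z inp''"
        by (rule wp_next_pair[OF _ p]) (use Y Z(2) in \<open>auto simp: R_def unchanged_def\<close>)
      then show "wp max_num iterations next_pair_prog
        (\<lambda>X inp. R (Suc p) X inp \<and> (0 < X 7 \<longleftrightarrow> Suc p < n * n)) Z inp''"
      proof (rule wp_mono, elim conjE)
        fix W inp3
        assume W: "inp3 = inp''" "unchanged {7, 8, 10, 11, 12} Z W" "W 7 = n * n - Suc p" "W 8 = Suc p"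
          "W 10 = Suc p div n" "W 11 = Suc p mod n"
        have "unchanged ?S X W"
          by (rule unchanged_trans[OF unchanged_trans[OF _ Z(2)] W(2)]) (use Y in \<open>auto simp: R_def\<close>)
        moreover have "W 0 = Y 0"
          using unchangedD[OF W(2), of 0] unchangedD[OF Z(2), of 0] by auto
        moreover have "W (cell 3 j) = Z (cell 3 j)" for j
          using unchangedD[OF W(2), of "cell 3 j"] by simp
        moreover have "p < n * n" by (rule p)
        ultimately show "R (Suc p) W inp3 \<and> (0 < W 7 \<longleftrightarrow> Suc p < n * n)"
          using Y Z(1,3) W(1,3-) unfolding R_def less_Suc_eq by auto
      qed
    qed
    then show ?thesis
      by simp
  qed
  have init: "R 0 (X(0 := (if X 9 = 0 then 1 else X 0), 10 := 0, 11 := 0, 8 := 0, 7 := n * n)) inp"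
    using n by (auto simp: R_def unchanged_def)
  have loop: "wp max_num iterations (Repeat False 7 (pair_prog ;; next_pair_prog))
    (\<lambda>X' inp'. inp' = inp \<and> X' 0 = (if X 9 = 0 then 1 else X 0) \<and> unchanged ?S X X' \<and>
      (\<forall>j. X' (cell 3 j) = (if \<exists>v < n. \<exists>y < n. grow entry k v y j then 1 else X (cell 3 j)))) Y inp"
    if "R 0 Y inp" for Y
    apply (rule wp_Repeat[where K = "n * n" and R = R])
    subgoal using n by simp
    subgoal by simp
    subgoal by (rule that)
    subgoal by (rule step)
    subgoal by (simp add: R_def pairs)
    done
  have "n * n \<le> max_num"
    using sizes by linarith
  moreover note loop[OF init]
  ultimately show ?thesis
    unfolding expand_prog_def
    by (cases "X 9 = 0") (simp_all add: B fun_upd_idem del: wp.simps(4))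
qed

text \<open>The marks present just before code \<open>k\<close> is examined; the disjunct
  \<open>j = 0\<close> is the mark set at the start.\<close>

definition found :: "nat \<Rightarrow> nat \<Rightarrow> bool" where
  "found k j \<longleftrightarrow> j = 0 \<or> (\<exists>k0 < k. profile n entry k0 \<and> (\<exists>v < n. \<exists>y < n. grow entry k0 v y j))"

text \<open>Successors are larger than their origin, so every predecessor of \<open>k\<close> has
  been expanded already and the mark of \<open>k\<close> is final when it is read.\<close>

lemma found_self: "found k k \<longleftrightarrow> profile n entry k"
proof
  assume "profile n entry k"
  then show "found k k"
    unfolding found_def by cases (auto dest: grow_increasing)
qed (auto simp: found_def intro: profile.intros)

lemma found_Suc:
  "found (Suc k) j \<longleftrightarrow> found k j \<or> (profile n entry k \<and> (\<exists>v < n. \<exists>y < n. grow entry k v y j))"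
  unfolding found_def less_Suc_eq by blast

lemma wp_search:
  assumes X: "base X" "X 0 = 0" "\<forall>j. X (cell 3 j) = 0"
  shows "wp max_num iterations search_prog
    (\<lambda>X' _. X' 0 = (if \<exists>k < 4 ^ n. profile n entry k \<and> (\<forall>i < n. odd (dig k i)) then 1 else 0)) X inp"
proof -
  have B: "X 3 = 4 ^ n" "X 22 = 1" "X 21 = 0"
    using X by (simp_all add: base_def)
  define a where "a = (\<lambda>k. \<exists>k0 < k. profile n entry k0 \<and> (\<forall>i < n. odd (dig k0 i)))"
  define R where "R = (\<lambda>k X' inp'. base X' \<and> X' 6 = k \<and> X' 5 = 4 ^ n - k \<and>
    X' 0 = (if a k then 1 else 0) \<and> (\<forall>j. X' (cell 3 j) = (if found k j then 1 else (0::nat))) \<and> inp' = inp)"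
  have a_Suc: "a (Suc k) \<longleftrightarrow> a k \<or> (profile n entry k \<and> (\<forall>i < n. odd (dig k i)))" for k
    unfolding a_def less_Suc_eq by blast
  have step: "wp max_num iterations search_step (\<lambda>X inp. R (Suc k) X inp \<and> (0 < X 5 \<longleftrightarrow> Suc k < 4 ^ n)) Y inp'"
    if k: "k < 4 ^ n" and Y: "R k Y inp'" for k Y inp'
  proof -
    define R' where "R' = (\<lambda>X inp. R (Suc k) X inp \<and> (0 < X 5 \<longleftrightarrow> Suc k < 4 ^ n))"
    have Y': "base Y" "Y 6 = k" "Y 5 = 4 ^ n - k" "Y 0 = (if a k then 1 else 0)"
      "\<And>j. Y (cell 3 j) = (if found k j then 1 else 0)" "inp' = inp"
      using Y by (simp_all add: R_def)
    let ?c = "load 3 12 6 ;; Instr (Sub 12 22 12) ;; Unless 12 expand_prog ;; count_prog"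
    have last: "wp max_num iterations count_prog R' W inp"
      if W: "base W" "W 6 = k" "W 5 = 4 ^ n - k" "W 0 = (if a (Suc k) then 1 else 0)"
        "\<forall>j. W (cell 3 j) = (if found (Suc k) j then 1 else 0)" for W
    proof -
      have "base (W(6 := Suc k, 5 := 4 ^ n - Suc k))"
        by (rule base_unchanged[OF W(1), of "{5, 6}"]) (auto simp: unchanged_def)
      moreover have "W 22 = 1"
        using W(1) by (simp add: base_def)
      moreover have "Suc k \<le> max_num"
        using k by linarith
      ultimately show ?thesis
        using W k by (simp add: count_prog_def R'_def R_def Suc_eq_plus1)
    qed
    have "wp max_num iterations decode_prog (\<lambda>X' inp'. inp' = inp \<and> (\<forall>i < n. X' (cell 2 i) = dig k i) \<and>
      (X' 9 = 0 \<longleftrightarrow> (\<forall>i < n. odd (dig k i))) \<and>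
      unchanged ({8, 9, 12, 13, 14, 15, 18, 19, 20} \<union> range (cell 2)) Y X') Y inp"
      using Y'(1,2) k by (rule wp_decode)
    then have "wp max_num iterations decode_prog (wp max_num iterations ?c R') Y inp"
    proof (rule wp_mono, elim conjE)
      fix Z inp2
      assume Z: "inp2 = inp" "\<forall>i < n. Z (cell 2 i) = dig k i" "Z 9 = 0 \<longleftrightarrow> (\<forall>i < n. odd (dig k i))"
        and U: "unchanged ({8, 9, 12, 13, 14, 15, 18, 19, 20} \<union> range (cell 2)) Y Z"
      have Z': "Z 6 = k" "Z 5 = 4 ^ n - k" "Z 0 = (if a k then 1 else 0)"
        "\<And>j. Z (cell 3 j) = (if found k j then 1 else 0)"
        using Y' by (simp_all add: unchangedD[OF U])
      have bZ: "base Z"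
        by (rule base_unchanged[OF Y'(1) U]) auto
      then have Z22: "Z 22 = 1"
        by (simp add: base_def)
      have cell: "cell 3 k \<le> max_num"
        using k by (intro cell_le) simp_all
      \<comment> \<open>The state after loading and complementing the mark of \<open>k\<close>,
        which by \<open>found_self\<close> tells whether \<open>k\<close> is a profile.\<close>
      define V where "V = Z(14 := cell 3 k, 15 := 35, 12 := 1 - (if profile n entry k then 1 else 0))"
      have V: "unchanged {12, 14, 15} Z V"
        by (simp add: V_def unchanged_def)
      have bV: "base V"
        by (rule base_unchanged[OF bZ V]) auto
      have V': "V 6 = k" "V 5 = 4 ^ n - k" "V 0 = (if a k then 1 else 0)"
        "\<And>j. V (cell 3 j) = (if found k j then 1 else 0)" "\<forall>i < n. V (cell 2 i) = dig k i" "V 9 = Z 9"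
        using Z' Z(2) by (simp_all add: V_def)
      have "if profile n entry k then wp max_num iterations expand_prog (wp max_num iterations count_prog R') V inp
        else wp max_num iterations count_prog R' V inp"
      proof (cases "profile n entry k")
        case True
        let ?S = "{0, 7, 8, 10, 11, 12, 13, 14, 15, 16, 17} \<union> range (cell 3)"
        have "wp max_num iterations expand_prog
          (\<lambda>X' inp'. inp' = inp \<and> X' 0 = (if V 9 = 0 then 1 else V 0) \<and> unchanged ?S V X' \<and>
            (\<forall>j. X' (cell 3 j) = (if \<exists>v < n. \<exists>y < n. grow entry k v y j then 1 else V (cell 3 j)))) V inp"
          using bV V'(1) k V'(5) by (rule wp_expand)
        then have "wp max_num iterations expand_prog (wp max_num iterations count_prog R') V inp"
        proof (rule wp_mono, elim conjE)
          fix W inp3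
          assume W: "inp3 = inp" "W 0 = (if V 9 = 0 then 1 else V 0)" "unchanged ?S V W"
            "\<forall>j. W (cell 3 j) = (if \<exists>v < n. \<exists>y < n. grow entry k v y j then 1 else V (cell 3 j))"
          have bW: "base W"
            by (rule base_unchanged[OF bV W(3)]) auto
          show "wp max_num iterations count_prog R' W inp3"
            unfolding W(1)
          proof (rule last[OF bW])
            show "W 6 = k" "W 5 = 4 ^ n - k"
              using V' by (simp_all add: unchangedD[OF W(3)])
            show "W 0 = (if a (Suc k) then 1 else 0)"
              using True Z(3) by (simp add: W(2) V'(3,6) a_Suc)
            show "\<forall>j. W (cell 3 j) = (if found (Suc k) j then 1 else 0)"
              using True by (simp add: W(4) V'(4) found_Suc)
          qed
        qed
        with True show ?thesis by simp
      next
        case False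
        have "wp max_num iterations count_prog R' V inp"
          by (rule last[OF bV V'(1,2)]) (use False V' in \<open>simp_all add: a_Suc found_Suc\<close>)
        with False show ?thesis by simp
      qed
      then show "wp max_num iterations ?c R' Z inp2"
        unfolding Z(1)
        by (simp add: Z'(1) Z22 Z'(4) found_self cell V_def if_distrib cong: if_cong split: if_splits)
    qed
    then have "wp max_num iterations search_step R' Y inp"
      by (simp add: search_step_def del: wp_load)
    then show ?thesis
      unfolding R'_def Y'(6) .
  qed
  define Y where "Y = X(6 := 0, 14 := cell 3 0, 15 := 35, cell 3 0 := 1, 5 := 4 ^ n)"
  have "unchanged {5, 6, 14, 15, cell 3 0} X Y"
    by (auto simp: Y_def unchanged_def)
  then have "base Y"
    by (rule base_unchanged[OF X(1)]) auto
  then have init: "R 0 Y inp"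
    using X(2,3) by (simp add: R_def Y_def a_def found_def)
  have "wp max_num iterations (Repeat True 5 search_step)
    (\<lambda>X' _. X' 0 = (if a (4 ^ n) then 1 else 0)) Y inp"
    apply (rule wp_Repeat[where K = "4 ^ n" and R = R])
    subgoal by simp
    subgoal by simp
    subgoal by (rule init)
    subgoal by (rule step)
    subgoal by (simp add: R_def)
    done
  moreover have "cell 3 0 \<le> max_num"
    by (rule cell_le) simp_all
  ultimately have "wp max_num iterations search_prog (\<lambda>X' _. X' 0 = (if a (4 ^ n) then 1 else 0)) X inp"
    by (simp add: search_prog_def B Y_def)
  then show ?thesis
    unfolding a_def .
qed

lemma wp_hist:
  "wp max_num iterations hist_prog
    (\<lambda>X _. X 0 = (if \<exists>k < 4 ^ n. profile n entry k \<and> (\<forall>i < n. odd (dig k i)) then 1 else 0))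
    (\<lambda>_. 0) (n # rows)"
proof -
  define Q where "Q = (\<lambda>(X :: nat \<Rightarrow> nat) (_ :: nat list).
    X 0 = (if \<exists>k < 4 ^ n. profile n entry k \<and> (\<forall>i < n. odd (dig k i)) then 1 else 0))"
  define X0 where "X0 = (\<lambda>_ :: nat. 0 :: nat)(2 := n, 22 := 1, 12 := 0, 0 := 0)"
  have X0: "X0 2 = n" "X0 4 = 0" "X0 22 = 1" "X0 21 = 0" "X0 0 = 0" "\<And>a j. X0 (cell a j) = 0"
    by (simp_all add: X0_def)
  have "wp max_num iterations square_prog
    (wp max_num iterations read_prog (wp max_num iterations powers_prog (wp max_num iterations search_prog Q))) X0 rows"
  proof (rule wp_mono[OF wp_square], (rule X0)+, elim conjE)
    fix X1 inp1
    assume 1: "inp1 = rows" "X1 4 = n * n" and U1: "unchanged {4, 7} X0 X1"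
    have X1: "X1 2 = n" "X1 22 = 1" "X1 21 = 0" "X1 0 = 0" "\<And>a j. X1 (cell a j) = 0"
      by (simp_all add: unchangedD[OF U1] X0)
    show "wp max_num iterations read_prog (wp max_num iterations powers_prog (wp max_num iterations search_prog Q)) X1 inp1"
      unfolding 1(1)
    proof (rule wp_mono[OF wp_read], (rule X1 1)+, elim conjE)
      fix X2 inp2
      assume U2: "unchanged ({7, 8, 12, 14, 15} \<union> range (cell 0)) X1 X2"
        and 2: "\<forall>p < n * n. X2 (cell 0 p) = rows ! p"
      have X2: "X2 2 = n" "X2 4 = n * n" "X2 22 = 1" "X2 21 = 0" "X2 0 = 0" "\<And>j. X2 (cell 3 j) = 0"
        by (simp_all add: unchangedD[OF U2] X1 1)
      show "wp max_num iterations powers_prog (wp max_num iterations search_prog Q) X2 inp2"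
      proof (rule wp_mono[OF wp_powers], (rule X2)+, elim conjE)
        fix X3 inp3
        assume 3: "X3 3 = 4 ^ n" "\<forall>i < n. X3 (cell 1 i) = 4 ^ i"
          and U3: "unchanged ({3, 7, 8, 14, 15} \<union> range (cell 1)) X2 X3"
        show "wp max_num iterations search_prog Q X3 inp3"
          unfolding Q_def
          by (rule wp_search) (simp_all add: base_def 2 3 unchangedD[OF U3] X2)
      qed
    qed
  qed
  moreover have "n \<le> max_num"
    using sizes(1) by linarith
  ultimately have "wp max_num iterations hist_prog Q (\<lambda>_. 0) (n # rows)"
    using n by (simp add: hist_prog_def X0_def wp_Seq)
  then show ?thesis
    unfolding Q_def .
qed

end

section \<open>Correctness for all graphs and the running time\<close>

lemma wp_hist_small:
  assumes "n \<le> 1" "2 \<le> M"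
  shows "wp M b hist_prog (\<lambda>X _. X 0 = n) (\<lambda>_. 0) (n # rows)"
  using assms by (simp add: hist_prog_def)

lemma small_mono: "small M c \<Longrightarrow> M \<le> M' \<Longrightarrow> small M' c"
proof (induct c)
  case (Instr i)
  then show ?case by (cases i) simp_all
qed simp_all

lemmas prog_defs = hist_prog_def square_prog_def read_prog_def powers_prog_def search_prog_def
  search_step_def count_prog_def expand_prog_def next_pair_prog_def pair_prog_def mark_prog_def
  decode_prog_def decode_step_def digit_prog_def digit_step_def load_def store_def addr_def

text \<open>The largest literal in the program is 35, from \<open>addr\<close>. The value 64 is the
  bound \<open>64 * 4 ^ n\<close> at \<open>n = 0\<close>, from which \<open>small_mono\<close>
  reaches every \<open>n\<close>.\<close>

lemma small_hist_prog: "small 64 hist_prog"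
  by (simp add: prog_defs)

text \<open>\<open>entry\<close> reflects adjacency only for indices below \<open>n\<close>; this
  transfers reachability from the graph to the matrix.\<close>

lemma profile_cong:
  assumes "\<And>v y. v < n \<Longrightarrow> y < n \<Longrightarrow> E v y \<longleftrightarrow> E' v y"
  shows "profile n E k \<longleftrightarrow> profile n E' k"
proof -
  have "profile n E' k" if "profile n E k" "\<And>v y. v < n \<Longrightarrow> y < n \<Longrightarrow> E v y \<Longrightarrow> E' v y" for E E'
    using that(1)
  proof induct
    case (grow k v y k')
    then show ?case
      using that(2) by (intro profile.grow[of n E' k v y k']) (auto simp: grow_def)
  qed (rule profile.zero)
  then show ?thesis
    using assms by blast
qed

lemma nth_concat_map:
  "i < length us \<Longrightarrow> j < length vs \<Longrightarrow>
   concat (map (\<lambda>u. map (f u) vs) us) ! (i * length vs + j) = f (us ! i) (vs ! j)"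
proof (induct us arbitrary: i)
  case (Cons u us)
  then show ?case
    by (cases i) (simp_all add: nth_append)
qed simp

definition hist_time :: "nat \<Rightarrow> nat" where
  "hist_time n = time_bound (64 * 4 ^ n) (\<lambda>f. if f then 4 ^ n else n * n) hist_prog"

lemma hist_prog_correct: "decides_HIST_in_time (code 0 hist_prog) hist_time"
  unfolding decides_HIST_in_time_def
proof (intro allI impI, elim conjE)
  fix G :: "nat pair_pre_digraph" and vs
  assume G: "pair_graph G" and vs: "distinct vs" "set vs = pverts G"
  define n where "n = card (pverts G)"
  have len: "length vs = n"
    using vs distinct_card n_def by metis
  define f where "f = (\<lambda>u v. if (u, v) \<in> parcs G then 1 else (0 :: nat))"
  define rows where "rows = concat (map (\<lambda>u. map (f u) vs) vs)"
  have inp: "graph_input vs G = n # rows"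
    by (simp add: graph_input_def rows_def f_def len)
  have small: "small (64 * 4 ^ n) hist_prog"
    by (rule small_mono[OF small_hist_prog]) simp
  show "ram_answers_within (code 0 hist_prog) (graph_input vs G) (has_HIST G) (hist_time (card (pverts G)))"
    unfolding hist_time_def inp n_def[symmetric]
  proof (rule wp_answers[OF _ small])
    show "wp (64 * 4 ^ n) (\<lambda>f. if f then 4 ^ n else n * n) hist_prog
      (\<lambda>X _. X 0 = (if has_HIST G then 1 else 0)) (\<lambda>_. 0) (n # rows)"
    proof (cases "n \<le> 1")
      case True
      then have e: "n = (if has_HIST G then 1 else 0)"
        using has_HIST_small[OF G] by (auto simp: n_def)
      have "2 \<le> 64 * (4 :: nat) ^ n"
        using one_le_power[of "4 :: nat" n] by simp
      with True have "wp (64 * 4 ^ n) (\<lambda>f. if f then 4 ^ n else n * n) hist_prog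
        (\<lambda>X _. X 0 = n) (\<lambda>_. 0) (n # rows)"
        by (rule wp_hist_small)
      then show ?thesis
        unfolding e[symmetric] .
    next
      case False
      then have n: "2 \<le> n" by simp
      have nth: "rows ! (v * n + y) = f (vs ! v) (vs ! y)" if "v < n" "y < n" for v y
        using that nth_concat_map[of v vs y vs f] by (simp add: rows_def len)
      have length: "length rows = n * n"
        by (simp add: rows_def length_concat comp_def len sum_list_triv)
      have le: "rows ! p \<le> 1" if "p < n * n" for p
        using that nth[of "p div n" "p mod n"] n by (simp add: less_mult_imp_div_less f_def)
      have "profile n (\<lambda>v y. (vs ! v, vs ! y) \<in> parcs G) k \<longleftrightarrow> profile n (entry n rows) k" for k
        by (rule profile_cong) (simp add: entry_def[OF n length le] nth f_def)
      then have "has_HIST G \<longleftrightarrow> (\<exists>k < 4 ^ n. profile n (entry n rows) k \<and> (\<forall>i < n. odd (dig k i)))"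
        using has_HIST_iff_profile[OF G vs] n by (simp add: len)
      then show ?thesis
        using wp_hist[OF n length le] by simp
    qed
  qed
qed

text \<open>The bound is \<open>2 ^ (2 * n + 6)\<close>, of binary length \<open>2 * n + 7\<close>,
  and each step pays five such lengths.\<close>

lemma step_bound_power: "step_bound (64 * 4 ^ n) = 10 * n + 35"
proof -
  have "(64 :: nat) * 4 ^ n = 1 * 2 ^ (2 * n + 6)"
    by (simp add: power_add power_mult)
  moreover have "floorlog 2 (1 * 2 ^ (2 * n + 6)) = floorlog 2 1 + (2 * n + 6)"
    by (rule floorlog_power) simp_all
  moreover have "floorlog 2 1 = 1"
    by (simp add: floorlog_def)
  ultimately have "floorlog 2 (64 * 4 ^ n) = 2 * n + 7"
    by simp
  then show ?thesis
    by (simp add: step_bound_def bin_length_def)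
qed

text \<open>The search dominates: \<open>4 ^ n\<close> codes, \<open>n * n\<close> rounds in each
  inner loop and linear cost per instruction give order \<open>4 ^ n * n ^ 3\<close>, which the
  exponent 5 covers with slack.\<close>

lemma hist_time_bigo: "(\<lambda>n. real (hist_time n)) \<in> O(\<lambda>n. 4 ^ n * real n ^ 5)"
  unfolding hist_time_def
  apply (simp add: prog_defs step_bound_power)
  apply real_asymp
  done

theorem theorem7:
  shows "\<exists>P T k. decides_HIST_in_time P T \<and>
           (\<lambda>n. real (T n)) \<in> O(\<lambda>n. 4 ^ n * real n ^ k)"
  using hist_prog_correct hist_time_bigo by blast

end
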